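(* Let $\alpha(n)$ be defined as below. Then, as $n\to\infty$, $$\alpha(n)\le n^{5/6+o(1)},$$ i.e., for every $\delta>0$ we have $\alpha(n)\le n^{5/6+\delta}$ for all sufficiently large $n$. Equivalently, there are $n$-point sets in the plane with no four points on a line in which every subset of size $n^{5/6+o(1)}$ contains three collinear points.
   Context: A finite set of points in $\mathbb{R}^2$ is in general position if no three of its points lie on a common line. For a finite set $S\subset\mathbb{R}^2$, let $\alpha(S)$ denote the maximum size of a subset of $S$ in general position. Define $$\alpha(n)=\min\{\alpha(S): S\subset\mathbb{R}^2,\ |S|=n,\ \text{no four points of } S \text{ lie on a common line}\}.$$ *)

theory Defs
  imports "HOL-Analysis.Analysis"
begin

text \<open>Points of the plane are pairs of reals. Three points are collinear iff the
  cross product of b - a and c - a vanishes.\<close>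

definition collinear3 :: "real \<times> real \<Rightarrow> real \<times> real \<Rightarrow> real \<times> real \<Rightarrow> bool" where
  "collinear3 a b c \<longleftrightarrow>
     (fst b - fst a) * (snd c - snd a) - (snd b - snd a) * (fst c - fst a) = 0"

definition general_position :: "(real \<times> real) set \<Rightarrow> bool" where
  "general_position P \<longleftrightarrow>
     (\<forall>a\<in>P. \<forall>b\<in>P. \<forall>c\<in>P. a \<noteq> b \<and> a \<noteq> c \<and> b \<noteq> c \<longrightarrow> \<not> collinear3 a b c)"

definition no_four_on_line :: "(real \<times> real) set \<Rightarrow> bool" where
  "no_four_on_line S \<longleftrightarrow>
     (\<forall>L. (\<exists>p q. p \<noteq> q \<and> L = {x. collinear3 p q x}) \<longrightarrow> card (S \<inter> L) \<le> 3)"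

definition alpha_set :: "(real \<times> real) set \<Rightarrow> nat" where
  "alpha_set S = Max {card P | P. P \<subseteq> S \<and> general_position P}"

definition alpha :: "nat \<Rightarrow> nat" where
  "alpha n = Min {alpha_set S | S. finite S \<and> card S = n \<and> no_four_on_line S}"

end

theory Submission
  imports Defs "HOL-Real_Asymp.Real_Asymp"
begin

text \<open>
  The point set is a random subset of the cube \<open>[q]\<^sup>3\<close>, mapped to the plane by a projection that
  neither creates nor destroys collinearities. The cube has only \<open>O(q\<^sup>6 log q)\<close> collinear quadruples,
  so a random subset of about \<open>q\<^sup>2\<close> points loses at most half of its points when one point of
  every collinear quadruple is deleted. That it has no large subset in general position is a union
  bound, which needs few sets covering all subsets of the cube in general position. These
  containers come from supersaturation: if \<open>A\<close> is a subset of the cube of size \<open>a\<close>, then every one of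
  the roughly \<open>D\<^sup>3\<close> primitive directions of size at most \<open>D = a / (12 q\<^sup>2)\<close> splits half of
  \<open>A\<close> into disjoint collinear triples. Triples of different directions share at most one point, so
  they form an almost regular linear 3-graph on \<open>A\<close>, for which two greedy choices inside an
  independent set \<open>I\<close>, of about \<open>a / D\<^bsup>3/2\<^esup>\<close> points each, determine a set containing \<open>I\<close>
  that misses a positive fraction of \<open>A\<close>. Iterating down to sets of size \<open>q\<^bsup>8/3\<^esup>\<close> costs
  \<open>q\<^bsup>5/3 + o(1)\<^esup>\<close> choices, which yields the exponent \<open>(5/3) / 2 = 5/6\<close>. Taking \<open>q = p\<^sup>3\<close> makes all
  these powers integral.
\<close>

section \<open>Containers for linear triple systems\<close>

text \<open>States of a greedy process in which at most \<open>k\<close> choices from \<open>A\<close> were made. An upper bound for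
  their number bounds the number of containers, so no fingerprints need to be recorded.\<close>

fun reach :: "('a \<Rightarrow> 's \<Rightarrow> 's) \<Rightarrow> 's \<Rightarrow> 'a set \<Rightarrow> nat \<Rightarrow> 's set" where
  "reach f s A 0 = {s}"
| "reach f s A (Suc k) = reach f s A k \<union> (\<Union>t\<in>A. f t ` reach f s A k)"

lemma reach_mono:
  assumes "A \<subseteq> B"
  shows "reach f s A k \<subseteq> reach f s B k"
proof (induction k)
  case (Suc k)
  then show ?case using assms by (simp, blast)
qed simp

lemma reach_mono_steps: "j \<le> k \<Longrightarrow> reach f s A j \<subseteq> reach f s A k"
  by (rule lift_Suc_mono_le[of "reach f s A"]) auto

lemma finite_reach: "finite A \<Longrightarrow> finite (reach f s A k)"
  by (induction k) auto

lemma card_reach_le: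
  assumes "finite A"
  shows "card (reach f s A k) \<le> (card A + 1) ^ k"
proof (induction k)
  case (Suc k)
  have "card (reach f s A (Suc k))
      \<le> card (reach f s A k) + card (\<Union>t\<in>A. f t ` reach f s A k)"
    by (simp add: card_Un_le)
  also have "card (\<Union>t\<in>A. f t ` reach f s A k) \<le> (\<Sum>t\<in>A. card (f t ` reach f s A k))"
    using assms by (rule card_UN_le)
  also have "\<dots> \<le> (\<Sum>t\<in>A. card (reach f s A k))"
    by (intro sum_mono card_image_le finite_reach assms)
  finally have "card (reach f s A (Suc k)) \<le> (card A + 1) * card (reach f s A k)"
    by simp
  also have "\<dots> \<le> (card A + 1) * (card A + 1) ^ k"
    using Suc by (rule mult_le_mono2)
  finally show ?case by simp
qed simp

text \<open>A potential argument: each good choice raises \<open>\<phi>\<close> by at least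
  \<open>g\<close>, and \<open>\<phi>\<close> stays below \<open>k * g\<close>, so within
  \<open>k\<close> choices no good one is left. The choices come from \<open>I\<close>, but
  \<open>reach_mono\<close> later places the final state in a family that depends on
  \<open>A\<close> alone.\<close>

lemma greedy_terminates:
  fixes \<phi> :: "'s \<Rightarrow> nat"
  assumes init: "P s"
    and step: "\<And>t x. t \<in> I \<Longrightarrow> P x \<Longrightarrow> P (f t x)"
    and bound: "\<And>x. P x \<Longrightarrow> \<phi> x \<le> B"
    and gain: "\<And>t x. t \<in> I \<Longrightarrow> P x \<Longrightarrow> good t x \<Longrightarrow> \<phi> x + g \<le> \<phi> (f t x)"
    and "B < k * g"
  shows "\<exists>x\<in>reach f s I k. P x \<and> (\<forall>t\<in>I. \<not> good t x)"
proof (rule ccontr)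
  assume "\<not> ?thesis"
  then have stuck: "\<exists>t\<in>I. good t x" if "x \<in> reach f s I k" "P x" for x
    using that by blast
  have "\<exists>x\<in>reach f s I j. P x \<and> j * g \<le> \<phi> x" if "j \<le> k" for j
    using that
  proof (induction j)
    case 0
    then show ?case using init by simp
  next
    case (Suc j)
    then obtain x where x: "x \<in> reach f s I j" "P x" "j * g \<le> \<phi> x" by auto
    moreover have "x \<in> reach f s I k"
      using x(1) reach_mono_steps[of j k] Suc.prems by (meson Suc_leD subsetD)
    ultimately obtain t where t: "t \<in> I" "good t x" using stuck by blast
    have "f t x \<in> reach f s I (Suc j)" using x(1) t(1) by auto
    moreover have "Suc j * g \<le> \<phi> (f t x)"
      using gain[OF t(1) x(2) t(2)] x(3) by simp
    ultimately show ?case using step[OF t(1) x(2)] by blast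
  qed
  from this[OF order_refl] obtain x where "P x" "k * g \<le> \<phi> x" by blast
  with bound[of x] \<open>B < k * g\<close> show False by linarith
qed

text \<open>Containers for the subsets of \<open>A\<close> with property \<open>P\<close>. The
  containers may violate \<open>P\<close>; keeping them inside \<open>A\<close> lets the
  construction be repeated within each of them.\<close>

definition covering :: "('a set \<Rightarrow> bool) \<Rightarrow> 'a set \<Rightarrow> 'a set set \<Rightarrow> bool" where
  "covering P A \<C> \<longleftrightarrow> finite \<C> \<and> (\<forall>C\<in>\<C>. C \<subseteq> A) \<and> (\<forall>I\<subseteq>A. P I \<longrightarrow> (\<exists>C\<in>\<C>. I \<subseteq> C))"

lemma coveringE:
  assumes "covering P A \<C>" "I \<subseteq> A" "P I"
  obtains C where "C \<in> \<C>" "I \<subseteq> C"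
  using assms unfolding covering_def by blast

lemma covering_sub: "covering P A \<C> \<Longrightarrow> C \<in> \<C> \<Longrightarrow> C \<subseteq> A"
  and covering_finite: "covering P A \<C> \<Longrightarrow> finite \<C>"
  unfolding covering_def by blast+

lemma covering_singleton: "covering P A {A}"
  by (simp add: covering_def)

lemma covering_UN:
  assumes \<C>: "covering P A \<C>" and \<D>: "\<And>C. C \<in> \<C> \<Longrightarrow> covering P C (\<D> C)"
  shows "covering P A (\<Union>C\<in>\<C>. \<D> C)"
  unfolding covering_def
proof (intro conjI ballI allI impI)
  show "finite (\<Union>C\<in>\<C>. \<D> C)"
    using covering_finite[OF \<C>] covering_finite[OF \<D>] by blast
  show "D \<subseteq> A" if "D \<in> (\<Union>C\<in>\<C>. \<D> C)" for D
    using that covering_sub[OF \<C>] covering_sub[OF \<D>] by blast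
  fix I assume "I \<subseteq> A" "P I"
  then obtain C where C: "C \<in> \<C>" "I \<subseteq> C" by (rule coveringE[OF \<C>])
  from \<D>[OF C(1)] C(2) \<open>P I\<close> obtain D where "D \<in> \<D> C" "I \<subseteq> D" by (rule coveringE)
  then show "\<exists>D\<in>\<Union>C\<in>\<C>. \<D> C. I \<subseteq> D" using C(1) by blast
qed

text \<open>Linear 3-graphs, with each triple stored in all its orders. For triples of distinct
  points, the ordered pairs counted by \<open>degree_le\<close> make \<open>\<Delta>\<close> a bound
  on twice the usual degree.\<close>

locale linear_triples =
  fixes A :: "'a set" and E :: "('a \<times> 'a \<times> 'a) set" and \<Delta> :: nat
  assumes finite_A: "finite A"
    and E_sub: "E \<subseteq> A \<times> A \<times> A"
    and swap12: "(x, y, z) \<in> E \<Longrightarrow> (y, x, z) \<in> E"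
    and swap23: "(x, y, z) \<in> E \<Longrightarrow> (x, z, y) \<in> E"
    and linear: "(x, y, z) \<in> E \<Longrightarrow> (x, y, z') \<in> E \<Longrightarrow> z = z'"
    and degree_le: "x \<in> A \<Longrightarrow> card {(y, z). (x, y, z) \<in> E} \<le> \<Delta>"
begin

definition indep :: "'a set \<Rightarrow> bool" where
  "indep I \<longleftrightarrow> (\<forall>x y z. (x, y, z) \<in> E \<longrightarrow> x \<in> I \<longrightarrow> y \<in> I \<longrightarrow> z \<notin> I)"

text \<open>For chosen points \<open>t\<close> of an independent set \<open>I\<close>, the pairs forming a triple with \<open>t\<close> are
  collected in a graph \<open>G\<close>, in which \<open>I\<close> is again independent. Pairs are only added between
  vertices of degree below \<open>r\<close>; as the link of \<open>t\<close> is a matching, all degrees stay at most \<open>r\<close>.\<close>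

definition unsat :: "nat \<Rightarrow> ('a \<times> 'a) set \<Rightarrow> 'a set" where
  "unsat r G = {x \<in> A. card (G `` {x}) < r}"

definition link :: "nat \<Rightarrow> ('a \<times> 'a) set \<Rightarrow> 'a \<Rightarrow> ('a \<times> 'a) set" where
  "link r G t = {(x, y). (t, x, y) \<in> E \<and> x \<in> unsat r G \<and> y \<in> unsat r G}"

definition add_link :: "nat \<Rightarrow> 'a \<Rightarrow> ('a \<times> 'a) set \<Rightarrow> ('a \<times> 'a) set" where
  "add_link r t G = G \<union> link r G t"

definition link_state :: "nat \<Rightarrow> 'a set \<Rightarrow> ('a \<times> 'a) set \<Rightarrow> bool" where
  "link_state r I G \<longleftrightarrow> (\<forall>x y. (x, y) \<in> G \<longrightarrow> (\<exists>t\<in>I. (t, x, y) \<in> E))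
     \<and> (\<forall>x. card (G `` {x}) \<le> r) \<and> sym G"

definition add_nbrs :: "('a \<times> 'a) set \<Rightarrow> 'a \<Rightarrow> 'a set \<Rightarrow> 'a set" where
  "add_nbrs G t X = X \<union> G `` {t}"

text \<open>If \<open>G\<close> stays sparse, few vertices are saturated, so a typical vertex still has a large link
  and cannot belong to \<open>I\<close>. If \<open>G\<close> becomes dense, a second greedy choice removes the
  \<open>G\<close>-neighbourhood \<open>X\<close> of further points of \<open>I\<close>.\<close>

definition container :: "nat \<Rightarrow> ('a \<times> 'a) set \<Rightarrow> 'a set \<Rightarrow> 'a set" where
  "container r G X = (if 16 * card G < card A * r
     then {t \<in> A. 8 * card (link r G t - G) < \<Delta>}
     else {u \<in> A - X. 32 * card (G `` {u} - X) < r})"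

section \<open>Each container misses a positive fraction of the vertices\<close>

lemma finite_E: "finite E"
  using E_sub finite_A by (meson finite_SigmaI finite_subset)

lemma finite_link: "finite {(y, z). (x, y, z) \<in> E}"
  by (rule finite_subset[of _ "A \<times> A"]) (use E_sub finite_A in auto)

lemma card_first_in_le:
  assumes "B \<subseteq> A"
  shows "card {(x, y, z) \<in> E. x \<in> B} \<le> card B * \<Delta>"
proof -
  have "{(x, y, z) \<in> E. x \<in> B} = (SIGMA x:B. {(y, z). (x, y, z) \<in> E})" by auto
  then have "card {(x, y, z) \<in> E. x \<in> B} = (\<Sum>x\<in>B. card {(y, z). (x, y, z) \<in> E})"
    using finite_link assms finite_A by (simp add: card_SigmaI finite_subset)
  also have "\<dots> \<le> (\<Sum>x\<in>B. \<Delta>)"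
    using assms degree_le by (intro sum_mono) auto
  finally show ?thesis by simp
qed

lemma card_second_in_le:
  assumes "B \<subseteq> A"
  shows "card {(x, y, z) \<in> E. y \<in> B} \<le> card B * \<Delta>"
proof -
  have "{(x, y, z) \<in> E. y \<in> B} \<subseteq> (\<lambda>(x, y, z). (y, x, z)) ` {(x, y, z) \<in> E. x \<in> B}"
    using swap12 by (force simp: image_iff)
  then have "card {(x, y, z) \<in> E. y \<in> B} \<le> card {(x, y, z) \<in> E. x \<in> B}"
    by (rule surj_card_le[rotated]) (auto intro: finite_subset[OF _ finite_E])
  also have "\<dots> \<le> card B * \<Delta>" using assms by (rule card_first_in_le)
  finally show ?thesis .
qed

lemma card_third_in_le:
  assumes "B \<subseteq> A"
  shows "card {(x, y, z) \<in> E. z \<in> B} \<le> card B * \<Delta>"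
proof -
  have "{(x, y, z) \<in> E. z \<in> B} \<subseteq> (\<lambda>(x, y, z). (x, z, y)) ` {(x, y, z) \<in> E. y \<in> B}"
    using swap23 by (force simp: image_iff)
  then have "card {(x, y, z) \<in> E. z \<in> B} \<le> card {(x, y, z) \<in> E. y \<in> B}"
    by (rule surj_card_le[rotated]) (auto intro: finite_subset[OF _ finite_E])
  also have "\<dots> \<le> card B * \<Delta>" using assms by (rule card_second_in_le)
  finally show ?thesis .
qed

lemma link_state_sub:
  assumes "link_state r I G"
  shows "G \<subseteq> A \<times> A"
  using assms E_sub unfolding link_state_def by fast

lemma link_state_finite:
  assumes "link_state r I G"
  shows "finite G"
  using link_state_sub[OF assms] finite_A by (meson finite_SigmaI finite_subset)

lemma link_state_card_eq:
  assumes "link_state r I G"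
  shows "card G = (\<Sum>x\<in>A. card (G `` {x}))"
proof -
  have "G = (SIGMA x:A. G `` {x})" using link_state_sub[OF assms] by auto
  moreover have "finite (G `` {x})" for x
    using link_state_finite[OF assms] by (rule finite_Image)
  ultimately show ?thesis using finite_A by (metis card_SigmaI)
qed

lemma link_state_card_le:
  assumes "link_state r I G"
  shows "card G \<le> card A * r"
proof -
  have "(\<Sum>x\<in>A. card (G `` {x})) \<le> (\<Sum>x\<in>A. r)"
    using assms by (intro sum_mono) (auto simp: link_state_def)
  then show ?thesis by (simp add: link_state_card_eq[OF assms])
qed

lemma link_state_add_link:
  assumes "t \<in> I" "link_state r I G"
  shows "link_state r I (add_link r t G)"
proof -
  have "card (add_link r t G `` {x}) \<le> r" for x
  proof (cases "x \<in> unsat r G")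
    case True
    have fin: "finite (G `` {x})"
      using link_state_finite[OF assms(2)] by (rule finite_Image)
    have "add_link r t G `` {x} \<subseteq> G `` {x} \<union> {y. (t, x, y) \<in> E}"
      by (auto simp: add_link_def link_def)
    moreover obtain y where "{y. (t, x, y) \<in> E} \<subseteq> {y}"
      using linear by blast
    ultimately have "add_link r t G `` {x} \<subseteq> insert y (G `` {x})" by blast
    then have "card (add_link r t G `` {x}) \<le> Suc (card (G `` {x}))"
      using card_mono[of "insert y (G `` {x})" "add_link r t G `` {x}"] fin
      by (simp add: card_insert_if split: if_splits)
    then show ?thesis using True by (simp add: unsat_def)
  next
    case False
    then have "add_link r t G `` {x} = G `` {x}"
      by (auto simp: add_link_def link_def)
    then show ?thesis using assms(2) by (simp add: link_state_def)
  qed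
  moreover have "sym (add_link r t G)"
    using assms swap23 unfolding sym_def link_state_def add_link_def link_def by auto
  ultimately show ?thesis
    using assms unfolding link_state_def add_link_def link_def by auto
qed

text \<open>Double counting of \<open>E\<close>. A triple \<open>(t, x, y)\<close> has a saturated
  end \<open>x\<close> or \<open>y\<close>, or starts outside the container, or gives a new link
  pair of a container point, or has its pair already in \<open>G\<close>. All classes but the second
  are too small to exhaust \<open>E\<close>, so many points lie outside the container.\<close>

lemma card_container_few_pairs:
  assumes G: "link_state r I G" and few: "16 * card G < card A * r"
    and "r \<le> \<Delta>" "card A * \<Delta> \<le> 2 * card E"
  shows "64 * card (container r G X) \<le> 63 * card A"
proof -
  define C where "C = {t \<in> A. 8 * card (link r G t - G) < \<Delta>}"
  define T where "T = A - unsat r G"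
  have C_sub: "C \<subseteq> A" and T_sub: "T \<subseteq> A" by (auto simp: C_def T_def)
  have finC: "finite C" using C_sub finite_A by (rule finite_subset)
  have finl: "finite (link r G t)" for t
    by (rule finite_subset[OF _ finite_link[of t]]) (auto simp: link_def)

  have "card T * r \<le> (\<Sum>x\<in>T. card (G `` {x}))"
    using sum_bounded_below[of T r "\<lambda>x. card (G `` {x})"]
    by (force simp: T_def unsat_def)
  also have "\<dots> \<le> card G"
    unfolding link_state_card_eq[OF G] by (intro sum_mono2 finite_A T_sub) auto
  finally have "(16 * card T) * r < card A * r" using few by linarith
  then have "16 * card T \<le> card A" by simp
  then have T: "16 * (card T * \<Delta>) \<le> card A * \<Delta>" by simp

  define R where "R = (SIGMA t:C. link r G t - G)"
  define Q where "Q = {(t, x, y) \<in> E. (x, y) \<in> G}"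
  have "card R = (\<Sum>t\<in>C. card (link r G t - G))"
    unfolding R_def using finl finC by (simp add: card_SigmaI)
  then have "8 * card R = (\<Sum>t\<in>C. 8 * card (link r G t - G))"
    by (simp add: sum_distrib_left)
  also have "\<dots> \<le> (\<Sum>t\<in>C. \<Delta>)"
    by (intro sum_mono) (auto simp: C_def)
  also have "\<dots> \<le> card A * \<Delta>" using card_mono[OF finite_A C_sub] by simp
  finally have R: "8 * card R \<le> card A * \<Delta>" .

  \<comment> \<open>By linearity a pair of \<open>G\<close> extends to at most one triple.\<close>
  have "inj_on snd Q"
  proof (rule inj_onI)
    fix a b assume "a \<in> Q" "b \<in> Q" "snd a = snd b"
    then obtain t s x y where "a = (t, x, y)" "b = (s, x, y)" "(t, x, y) \<in> E" "(s, x, y) \<in> E"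
      unfolding Q_def by auto
    then show "a = b" using linear[of x y t s] swap12 swap23 by blast
  qed
  moreover have "snd ` Q \<subseteq> G" by (auto simp: Q_def)
  ultimately have Q: "card Q \<le> card G"
    using link_state_finite[OF G] by (meson card_inj_on_le)

  have "E \<subseteq> ({(t, x, y) \<in> E. x \<in> T} \<union> {(t, x, y) \<in> E. y \<in> T}) \<union> {(t, x, y) \<in> E. t \<in> A - C}
      \<union> R \<union> Q"
  proof
    fix e assume "e \<in> E"
    moreover obtain t x y where "e = (t, x, y)" by (cases e)
    moreover have "t \<in> A" "x \<in> A" "y \<in> A" using calculation E_sub by auto
    ultimately show "e \<in> ({(t, x, y) \<in> E. x \<in> T} \<union> {(t, x, y) \<in> E. y \<in> T})
        \<union> {(t, x, y) \<in> E. t \<in> A - C} \<union> R \<union> Q"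
      by (auto simp: R_def Q_def link_def T_def)
  qed
  then have "card E \<le> card (({(t, x, y) \<in> E. x \<in> T} \<union> {(t, x, y) \<in> E. y \<in> T})
      \<union> {(t, x, y) \<in> E. t \<in> A - C} \<union> R \<union> Q)"
    by (rule card_mono[rotated]) (use finl finC in \<open>auto simp: R_def Q_def intro: finite_subset[OF _ finite_E]\<close>)
  also have "\<dots> \<le> card {(t, x, y) \<in> E. x \<in> T} + card {(t, x, y) \<in> E. y \<in> T}
      + card {(t, x, y) \<in> E. t \<in> A - C} + card R + card Q"
    by (meson add_le_mono card_Un_le order_refl order_trans)
  also have "\<dots> \<le> card T * \<Delta> + card T * \<Delta> + card (A - C) * \<Delta> + card R + card G"
    using Q by (intro add_mono card_first_in_le card_second_in_le card_third_in_le T_sub) auto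
  finally have E: "card E \<le> 2 * (card T * \<Delta>) + card (A - C) * \<Delta> + card R + card G"
    by simp
  have "card A * r \<le> card A * \<Delta>" using \<open>r \<le> \<Delta>\<close> by simp
  then have "16 * card G < card A * \<Delta>" using few by linarith
  \<comment> \<open>In units of \<open>card A * \<Delta>\<close>: \<open>E\<close> has at least 1/2,
    saturated ends take at most 2/16, \<open>R\<close> at most 1/8 and \<open>Q\<close> at most
    1/16, which leaves 3/16 = 6/32.\<close>
  then have "6 * (card A * \<Delta>) \<le> 32 * (card (A - C) * \<Delta>)"
    using E T R \<open>card A * \<Delta> \<le> 2 * card E\<close> by linarith
  then have "(6 * card A) * \<Delta> \<le> (32 * card (A - C)) * \<Delta>" by simp
  moreover have "0 < \<Delta>" using few \<open>r \<le> \<Delta>\<close> by (cases \<Delta>) auto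
  ultimately have "6 * card A \<le> 32 * card (A - C)" by simp
  moreover have "card (A - C) = card A - card C" "card C \<le> card A"
    using C_sub finite_A finC by (auto simp: card_Diff_subset card_mono)
  moreover have "container r G X = C" using few by (simp add: container_def C_def)
  ultimately show ?thesis by simp
qed

text \<open>Double counting of \<open>G\<close>. A pair starts outside the container, or ends in
  \<open>X\<close>, or starts in the container and ends outside \<open>X\<close>. The last kind
  accounts for at most half of the assumed \<open>card A * r / 16\<close> pairs, and every vertex
  starts or ends at most \<open>r\<close> pairs.\<close>

lemma card_container_many_pairs:
  assumes G: "link_state r I G" and many: "card A * r \<le> 16 * card G"
    and "0 < r" "X \<subseteq> A"
  shows "64 * card (container r G X) \<le> 63 * card A"
proof -
  define C where "C = {u \<in> A - X. 32 * card (G `` {u} - X) < r}"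
  have C_sub: "C \<subseteq> A" by (auto simp: C_def)
  have finC: "finite C" and finX: "finite X"
    using C_sub \<open>X \<subseteq> A\<close> finite_A by (auto intro: finite_subset)
  have finG: "finite (G `` {x})" for x
    using link_state_finite[OF G] by (rule finite_Image)
  define R where "R = (SIGMA u:C. G `` {u} - X)"
  have "card R = (\<Sum>u\<in>C. card (G `` {u} - X))"
    unfolding R_def using finC finG by (simp add: card_SigmaI)
  then have "32 * card R = (\<Sum>u\<in>C. 32 * card (G `` {u} - X))"
    by (simp add: sum_distrib_left)
  also have "\<dots> \<le> (\<Sum>u\<in>C. r)" by (intro sum_mono) (auto simp: C_def)
  also have "\<dots> \<le> card A * r" using card_mono[OF finite_A C_sub] by simp
  finally have R: "32 * card R \<le> card A * r" .
  have out: "card (SIGMA u:B. G `` {u}) \<le> card B * r" if "B \<subseteq> A" for B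
  proof -
    have "card (SIGMA u:B. G `` {u}) = (\<Sum>u\<in>B. card (G `` {u}))"
      using finG that finite_A by (simp add: card_SigmaI finite_subset)
    also have "\<dots> \<le> (\<Sum>u\<in>B. r)"
      using G by (intro sum_mono) (auto simp: link_state_def)
    finally show ?thesis by simp
  qed
  have "sym G" using G by (simp add: link_state_def)
  have "G \<subseteq> (SIGMA u:A - C. G `` {u}) \<union> (\<lambda>(x, y). (y, x)) ` (SIGMA u:X. G `` {u}) \<union> R"
  proof
    fix e assume "e \<in> G"
    moreover obtain x y where "e = (x, y)" by (cases e)
    moreover have "x \<in> A" using calculation link_state_sub[OF G] by auto
    moreover have "(y, x) \<in> G" using calculation \<open>sym G\<close> by (auto dest: symD)
    ultimately show "e \<in> (SIGMA u:A - C. G `` {u})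
        \<union> (\<lambda>(x, y). (y, x)) ` (SIGMA u:X. G `` {u}) \<union> R"
      by (auto simp: R_def image_iff)
  qed
  then have "card G \<le> card ((SIGMA u:A - C. G `` {u})
      \<union> (\<lambda>(x, y). (y, x)) ` (SIGMA u:X. G `` {u}) \<union> R)"
    by (rule card_mono[rotated]) (use finite_A finX finC finG in \<open>auto simp: R_def\<close>)
  also have "\<dots> \<le> card (SIGMA u:A - C. G `` {u})
      + card ((\<lambda>(x, y). (y, x)) ` (SIGMA u:X. G `` {u})) + card R"
    by (meson add_le_mono card_Un_le order_refl order_trans)
  also have "\<dots> \<le> card (A - C) * r + card X * r + card R"
  proof -
    have "card ((\<lambda>(x, y). (y, x)) ` (SIGMA u:X. G `` {u})) \<le> card (SIGMA u:X. G `` {u})"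
      by (rule card_image_le) (use finX finG in auto)
    then show ?thesis using out[OF \<open>X \<subseteq> A\<close>] out[of "A - C"] by auto
  qed
  finally have "card G \<le> card (A - C) * r + card X * r + card R" .
  \<comment> \<open>The container avoids \<open>X\<close>, so one bound serves for both remaining
    kinds of pairs; this turns 1/32 into the final 1/64.\<close>
  moreover have "card X * r \<le> card (A - C) * r"
    using \<open>X \<subseteq> A\<close> finite_A by (intro mult_le_mono1 card_mono) (auto simp: C_def)
  ultimately have "card A * r \<le> (64 * card (A - C)) * r"
    using R many by linarith
  then have "card A \<le> 64 * card (A - C)" using \<open>0 < r\<close> by simp
  moreover have "card (A - C) = card A - card C" "card C \<le> card A"
    using C_sub finite_A finC by (auto simp: card_Diff_subset card_mono)
  moreover have "container r G X = C" using many by (simp add: container_def C_def)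
  ultimately show ?thesis by simp
qed

text \<open>Both greedy processes run on points of \<open>I\<close>. The first has potential
  \<open>8 * card G\<close>, at most \<open>8 * (card A * r)\<close>, with gain
  \<open>\<Delta>\<close>; the second has potential \<open>32 * card X\<close>, at most
  \<open>32 * card A\<close>, with gain \<open>r\<close>. That neither can continue says precisely
  that every point of \<open>I\<close> passes the test defining the container.\<close>

lemma indep_sub_container:
  assumes "I \<subseteq> A" "indep I"
    and K1: "8 * (card A * r) < K * \<Delta>" and K2: "32 * card A < K * r"
  obtains G X where "G \<in> reach (add_link r) {} A K" "X \<in> reach (add_nbrs G) {} A K"
    "link_state r I G" "X \<subseteq> A" "I \<subseteq> container r G X"
proof -
  have "\<exists>G\<in>reach (add_link r) {} I K. link_state r I G
      \<and> (\<forall>t\<in>I. \<not> \<Delta> \<le> 8 * card (link r G t - G))"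
  proof (rule greedy_terminates[where \<phi> = "\<lambda>G. 8 * card G" and g = \<Delta> and B = "8 * (card A * r)"])
    fix t G assume "t \<in> I" "link_state r I G" "\<Delta> \<le> 8 * card (link r G t - G)"
    moreover have "card (add_link r t G) = card G + card (link r G t - G)"
    proof -
      have "finite (link r G t)"
        by (rule finite_subset[OF _ finite_link[of t]]) (auto simp: link_def)
      moreover have "add_link r t G = G \<union> (link r G t - G)" by (auto simp: add_link_def)
      ultimately show ?thesis
        using link_state_finite[OF \<open>link_state r I G\<close>]
        by (metis Diff_disjoint card_Un_disjoint finite_Diff)
    qed
    ultimately show "8 * card G + \<Delta> \<le> 8 * card (add_link r t G)" by simp
  next
    show "link_state r I {}" by (simp add: link_state_def sym_def)
  qed (use K1 link_state_add_link link_state_card_le in auto)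
  then obtain G where G: "G \<in> reach (add_link r) {} I K" "link_state r I G"
    and endG: "\<And>t. t \<in> I \<Longrightarrow> \<not> \<Delta> \<le> 8 * card (link r G t - G)" by blast
  define P where "P = (\<lambda>X. X \<subseteq> A \<and> X \<inter> I = {})"
  have "\<exists>X\<in>reach (add_nbrs G) {} I K. P X \<and> (\<forall>t\<in>I. \<not> r \<le> 32 * card (G `` {t} - X))"
  proof (rule greedy_terminates[where \<phi> = "\<lambda>X. 32 * card X" and g = r and B = "32 * card A"])
    fix t X assume "t \<in> I" "P X"
    \<comment> \<open>A pair \<open>(t, y)\<close> of \<open>G\<close> comes from a triple
      \<open>(s, t, y)\<close> with \<open>s\<close> in \<open>I\<close>; since \<open>t\<close> is
      in \<open>I\<close> too, independence keeps \<open>y\<close> out of \<open>I\<close>.\<close>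
    then show "P (add_nbrs G t X)"
      using link_state_sub[OF G(2)] G(2) \<open>indep I\<close>
      unfolding P_def add_nbrs_def link_state_def indep_def by blast
  next
    fix t X assume "t \<in> I" "P X" "r \<le> 32 * card (G `` {t} - X)"
    moreover have "card (add_nbrs G t X) = card X + card (G `` {t} - X)"
    proof -
      have "finite X" using \<open>P X\<close> finite_A by (auto simp: P_def intro: finite_subset)
      moreover have "finite (G `` {t})" using link_state_finite[OF G(2)] by (rule finite_Image)
      moreover have "add_nbrs G t X = X \<union> (G `` {t} - X)" by (auto simp: add_nbrs_def)
      ultimately show ?thesis by (metis Diff_disjoint card_Un_disjoint finite_Diff)
    qed
    ultimately show "32 * card X + r \<le> 32 * card (add_nbrs G t X)" by simp
  qed (use K2 finite_A card_mono in \<open>auto simp: P_def\<close>)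
  then obtain X where X: "X \<in> reach (add_nbrs G) {} I K" "P X"
    and endX: "\<And>t. t \<in> I \<Longrightarrow> \<not> r \<le> 32 * card (G `` {t} - X)" by blast
  have "I \<subseteq> container r G X"
    using \<open>I \<subseteq> A\<close> X(2) endG endX by (auto simp: container_def P_def not_le)
  moreover have "G \<in> reach (add_link r) {} A K" "X \<in> reach (add_nbrs G) {} A K"
    by (rule subsetD[OF reach_mono[OF \<open>I \<subseteq> A\<close>]], fact)+
  ultimately show thesis using that G(2) X(2) by (simp add: P_def)
qed

lemma containers:
  assumes "card A * \<Delta> \<le> 2 * card E" "r \<le> \<Delta>"
    and K1: "8 * (card A * r) < K * \<Delta>" and K2: "32 * card A < K * r"
  obtains \<C> where "covering indep A \<C>" "card \<C> \<le> (card A + 1) ^ (2 * K)"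
    "\<And>C. C \<in> \<C> \<Longrightarrow> 64 * card C \<le> 63 * card A"
proof -
  define S where "S = (SIGMA G:reach (add_link r) {} A K. reach (add_nbrs G) {} A K)"
  define \<C> where "\<C> = {C \<in> (\<lambda>(G, X). container r G X) ` S. C \<subseteq> A \<and> 64 * card C \<le> 63 * card A}"
  have finS: "finite S"
    unfolding S_def by (intro finite_SigmaI finite_reach finite_A)
  have "card S = (\<Sum>G\<in>reach (add_link r) {} A K. card (reach (add_nbrs G) {} A K))"
    unfolding S_def by (intro card_SigmaI ballI finite_reach finite_A)
  also have "\<dots> \<le> (\<Sum>G\<in>reach (add_link r) {} A K. (card A + 1) ^ K)"
    by (intro sum_mono card_reach_le finite_A)
  also have "\<dots> \<le> (card A + 1) ^ K * (card A + 1) ^ K"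
    using card_reach_le[OF finite_A] by simp
  finally have cardS: "card S \<le> (card A + 1) ^ (2 * K)"
    by (simp add: mult_2 power_add)
  show thesis
  proof
    have "card \<C> \<le> card ((\<lambda>(G, X). container r G X) ` S)"
      using finS by (intro card_mono) (auto simp: \<C>_def)
    also have "\<dots> \<le> card S" using finS by (rule card_image_le)
    finally show "card \<C> \<le> (card A + 1) ^ (2 * K)" using cardS by linarith
    show "64 * card C \<le> 63 * card A" if "C \<in> \<C>" for C
      using that by (simp add: \<C>_def)
    show "covering indep A \<C>"
      unfolding covering_def
    proof (intro conjI ballI allI impI)
      show "finite \<C>" using finS by (simp add: \<C>_def)
      show "C \<subseteq> A" if "C \<in> \<C>" for C using that by (simp add: \<C>_def)
    next
      fix I assume "I \<subseteq> A" "indep I"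
      then obtain G X where GX: "G \<in> reach (add_link r) {} A K" "X \<in> reach (add_nbrs G) {} A K"
        "link_state r I G" "X \<subseteq> A" "I \<subseteq> container r G X"
        using indep_sub_container K1 K2 by blast
      have "0 < r" using K2 by (cases r) auto
      then have "64 * card (container r G X) \<le> 63 * card A"
        using card_container_few_pairs[OF GX(3) _ assms(2,1)]
          card_container_many_pairs[OF GX(3) _ _ GX(4)] by (cases "16 * card G < card A * r") auto
      moreover have "container r G X \<subseteq> A" by (auto simp: container_def)
      moreover have "container r G X \<in> (\<lambda>(G, X). container r G X) ` S"
        using GX by (force simp: S_def)
      ultimately have "container r G X \<in> \<C>" unfolding \<C>_def by blast
      then show "\<exists>C\<in>\<C>. I \<subseteq> C" using GX(5) by blast
    qed
  qed
qed

end

text \<open>Each round replaces every container with more than \<open>s\<close> points by at most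
  \<open>N\<close> smaller ones and leaves the others alone, so \<open>k\<close> rounds cost a
  factor \<open>N ^ k\<close>.\<close>

lemma iterate_containers:
  fixes P :: "'a set \<Rightarrow> bool" and \<rho> :: real
  assumes "finite V" "1 \<le> N" "0 \<le> \<rho>"
    and step: "\<And>A. A \<subseteq> V \<Longrightarrow> s < card A \<Longrightarrow>
      \<exists>\<C>. covering P A \<C> \<and> card \<C> \<le> N \<and> (\<forall>C\<in>\<C>. real (card C) \<le> \<rho> * card A)"
  shows "\<exists>\<C>. covering P V \<C> \<and> card \<C> \<le> N ^ k
      \<and> (\<forall>C\<in>\<C>. card C \<le> s \<or> real (card C) \<le> \<rho> ^ k * card V)"
proof (induction k)
  case 0
  show ?case using covering_singleton[of P V] by (intro exI[of _ "{V}"]) auto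
next
  case (Suc k)
  then obtain \<C> where \<C>: "covering P V \<C>" "card \<C> \<le> N ^ k"
    "\<And>C. C \<in> \<C> \<Longrightarrow> card C \<le> s \<or> real (card C) \<le> \<rho> ^ k * card V" by blast
  have "\<exists>\<D>. covering P A \<D> \<and> card \<D> \<le> N
      \<and> (\<forall>C\<in>\<D>. card C \<le> s \<or> real (card C) \<le> \<rho> * card A)" if "A \<subseteq> V" for A
  proof (cases "card A \<le> s")
    case True
    then show ?thesis
      using \<open>1 \<le> N\<close> covering_singleton[of P A] by (intro exI[of _ "{A}"]) auto
  next
    case False
    then show ?thesis using step[OF that] by (meson not_le)
  qed
  then obtain \<D> where "\<forall>A\<subseteq>V. covering P A (\<D> A) \<and> card (\<D> A) \<le> N
      \<and> (\<forall>C\<in>\<D> A. card C \<le> s \<or> real (card C) \<le> \<rho> * card A)"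
    by metis
  then have \<D>: "covering P A (\<D> A)" "card (\<D> A) \<le> N"
    "\<And>C. C \<in> \<D> A \<Longrightarrow> card C \<le> s \<or> real (card C) \<le> \<rho> * card A" if "A \<subseteq> V" for A
    using that by blast+
  note sub = covering_sub[OF \<C>(1)]
  show ?case
  proof (intro exI[of _ "\<Union>A\<in>\<C>. \<D> A"] conjI ballI)
    show "covering P V (\<Union>A\<in>\<C>. \<D> A)" using \<C>(1) \<D>(1) sub by (intro covering_UN) auto
    have "card (\<Union>A\<in>\<C>. \<D> A) \<le> (\<Sum>A\<in>\<C>. card (\<D> A))"
      using covering_finite[OF \<C>(1)] by (rule card_UN_le)
    also have "\<dots> \<le> (\<Sum>A\<in>\<C>. N)" using sub \<D>(2) by (intro sum_mono) blast
    also have "\<dots> \<le> N ^ Suc k" using \<C>(2) by simp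
    finally show "card (\<Union>A\<in>\<C>. \<D> A) \<le> N ^ Suc k" .
  next
    fix B assume "B \<in> (\<Union>A\<in>\<C>. \<D> A)"
    then obtain A where A: "A \<in> \<C>" "B \<in> \<D> A" by blast
    then have "A \<subseteq> V" using sub by blast
    then have B: "B \<subseteq> A" "card B \<le> s \<or> real (card B) \<le> \<rho> * card A"
      using covering_sub[OF \<D>(1)] \<D>(3) A(2) by blast+
    have "card B \<le> card A" using B(1) \<open>A \<subseteq> V\<close> \<open>finite V\<close> by (meson card_mono finite_subset)
    moreover have "\<rho> * card A \<le> \<rho> ^ Suc k * card V" if "real (card A) \<le> \<rho> ^ k * card V"
      using mult_left_mono[OF that \<open>0 \<le> \<rho>\<close>] by (simp add: mult.assoc)
    ultimately show "card B \<le> s \<or> real (card B) \<le> \<rho> ^ Suc k * card V"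
      using B(2) \<C>(3)[OF A(1)] by linarith
  qed
qed

section \<open>Supersaturation in the cube\<close>

type_synonym lpoint = "int \<times> int \<times> int"

definition cube :: "nat \<Rightarrow> lpoint set" where
  "cube q = {0..<int q} \<times> {0..<int q} \<times> {0..<int q}"

fun col :: "lpoint \<Rightarrow> lpoint \<Rightarrow> lpoint \<Rightarrow> bool" where
  "col (a1, a2, a3) (b1, b2, b3) (c1, c2, c3) \<longleftrightarrow>
     (b1 - a1) * (c2 - a2) = (b2 - a2) * (c1 - a1) \<and>
     (b1 - a1) * (c3 - a3) = (b3 - a3) * (c1 - a1) \<and>
     (b2 - a2) * (c3 - a3) = (b3 - a3) * (c2 - a2)"

definition no_three_col :: "lpoint set \<Rightarrow> bool" where
  "no_three_col P \<longleftrightarrow>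
     (\<forall>x\<in>P. \<forall>y\<in>P. \<forall>z\<in>P. x \<noteq> y \<and> x \<noteq> z \<and> y \<noteq> z \<longrightarrow> \<not> col x y z)"

fun ray :: "lpoint \<Rightarrow> int \<Rightarrow> lpoint \<Rightarrow> lpoint" where
  "ray (d1, d2, d3) k (x1, x2, x3) = (x1 + k * d1, x2 + k * d2, x3 + k * d3)"

definition same_line :: "lpoint \<Rightarrow> lpoint \<Rightarrow> lpoint \<Rightarrow> bool" where
  "same_line d x y \<longleftrightarrow> (\<exists>k. y = ray d k x)"

text \<open>Coprimality of the first two coordinates already makes distinct directions non-parallel.\<close>

definition dirs :: "nat \<Rightarrow> lpoint set" where
  "dirs D = {(a, b, c). a \<in> {1..int D} \<and> b \<in> {1..int D} \<and> c \<in> {1..int D} \<and> coprime a b}"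

lemma finite_cube: "finite (cube q)"
  by (simp add: cube_def)

lemma card_cube: "card (cube q) = q ^ 3"
  by (simp add: cube_def card_cartesian_product power3_eq_cube)

lemma ray_ray: "ray d j (ray d k x) = ray d (k + j) x"
  by (cases d; cases x) (auto simp: algebra_simps)

lemma ray_0 [simp]: "ray d 0 x = x"
  by (cases d; cases x) auto

lemma same_line_sym: "same_line d x y \<Longrightarrow> same_line d y x"
  unfolding same_line_def by (metis add.right_inverse ray_0 ray_ray)

lemma same_line_trans: "same_line d x y \<Longrightarrow> same_line d y z \<Longrightarrow> same_line d x z"
  unfolding same_line_def by (metis ray_ray)

lemma same_line_col:
  assumes "same_line d x y" "same_line d x z"
  shows "col x y z"
  using assms by (cases d; cases x) (auto simp: same_line_def)

text \<open>The two directions are proportional, so their first two coordinates form the same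
  reduced positive fraction and agree. Then the multipliers agree, and with them the third
  coordinates.\<close>

lemma dirs_unique:
  assumes "d \<in> dirs D" "d' \<in> dirs D" "same_line d x y" "same_line d' x y" "x \<noteq> y"
  shows "d = d'"
proof -
  obtain a b c a' b' c' where d: "d = (a, b, c)" "d' = (a', b', c')" by (cases d; cases d')
  obtain k k' where k: "y = ray d k x" "y = ray d' k' x"
    using assms unfolding same_line_def by blast
  have pos: "a > 0" "b > 0" "c > 0" "a' > 0" "b' > 0" "c' > 0"
    and cop: "coprime a b" "coprime a' b'"
    using assms(1,2) by (auto simp: d dirs_def)
  have eq: "k * a = k' * a'" "k * b = k' * b'" "k * c = k' * c'"
    using k by (cases x; auto simp: d)+
  have nz: "k \<noteq> 0" "k' \<noteq> 0" using k \<open>x \<noteq> y\<close> by auto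
  have "(k * k') * (a * b') = (k * k') * (a' * b)"
    using eq by (metis (no_types, opaque_lifting) mult.assoc mult.commute)
  then have "a * b' = a' * b" using nz by simp
  then have "\<bar>a\<bar> = \<bar>a'\<bar> \<and> \<bar>b\<bar> = \<bar>b'\<bar>"
    using cop coprime_crossproduct_int[of a b a' b'] by (metis abs_mult)
  then have "a = a'" "b = b'" using pos by auto
  moreover have "k = k'" using eq(1) \<open>a = a'\<close> pos by simp
  ultimately show ?thesis using eq(3) nz by (simp add: d)
qed

section \<open>The number of directions\<close>

lemma sum_inverse_squares_le: "(\<Sum>k=2..n. 1 / (real k)\<^sup>2) \<le> 3 / 4"
proof (cases "n \<ge> 2")
  case True
  \<comment> \<open>The extra term \<open>1 / real n\<close> makes the induction telescope, with
    equality at 2.\<close>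
  then have "(\<Sum>k=2..n. 1 / (real k)\<^sup>2) \<le> 3 / 4 - 1 / real n"
  proof (induction n rule: dec_induct)
    case base
    then show ?case by simp
  next
    case (step n)
    have "1 / (real (Suc n))\<^sup>2 \<le> 1 / real n - 1 / real (Suc n)"
    proof -
      have "1 / real n - 1 / real (Suc n) = 1 / (real n * real (Suc n))"
        using step.hyps by (simp add: field_simps)
      moreover have "1 / (real (Suc n) * real (Suc n)) \<le> 1 / (real n * real (Suc n))"
        using step.hyps by (intro divide_left_mono mult_right_mono) auto
      ultimately show ?thesis by (simp add: power2_eq_square)
    qed
    then show ?case using step by (simp add: sum.atLeast_Suc_atMost_Suc_shift)
  qed
  then show ?thesis by (smt (verit) divide_nonneg_nonneg of_nat_0_le_iff)
qed auto

text \<open>A pair with gcd \<open>k\<close> greater than 1 is \<open>k\<close> times a pair with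
  entries at most \<open>D div k\<close>. Summing \<open>(D / k)\<^sup>2\<close> over these
  \<open>k\<close> removes at most three quarters of all pairs.\<close>

lemma card_coprime_pairs:
  "D ^ 2 \<le> 4 * card {(a, b). a \<in> {1..int D} \<and> b \<in> {1..int D} \<and> coprime a b}"
proof -
  define S where "S = {1..int D} \<times> {1..int D}"
  define U where "U = {(a, b). a \<in> {1..int D} \<and> b \<in> {1..int D} \<and> coprime a b}"
  define F where "F = (\<lambda>k. (\<lambda>(a, b). (int k * a, int k * b)) `
    ({1..int (D div k)} \<times> {1..int (D div k)}))"
  have finU: "finite U" by (rule finite_subset[of _ S]) (auto simp: U_def S_def)
  have "S \<subseteq> U \<union> (\<Union>k\<in>{2..D}. F k)"
  proof
    fix e assume "e \<in> S"
    then obtain a b where e: "e = (a, b)" "1 \<le> a" "a \<le> D" "1 \<le> b" "b \<le> D"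
      by (auto simp: S_def)
    show "e \<in> U \<union> (\<Union>k\<in>{2..D}. F k)"
    proof (cases "coprime a b")
      case True
      then show ?thesis using e by (auto simp: U_def)
    next
      case False
      define g where "g = gcd a b"
      have g: "g \<noteq> 1" "g > 0" "g dvd a" "g dvd b"
        using False e by (auto simp: g_def coprime_iff_gcd_eq_1)
      then obtain a' b' where ab: "a = g * a'" "b = g * b'" by (elim dvdE)
      then have pos: "a' > 0" "b' > 0" 
        using e(2,4) g(2) by (auto intro: zero_less_mult_pos[of g])
      have "g \<le> D" using g(3) e by (meson zdvd_imp_le order_trans zero_less_one less_le_trans)
      have "a' \<le> int D div g" "b' \<le> int D div g"
        using zdiv_mono1[OF e(3) g(2)] zdiv_mono1[OF e(5) g(2)] g(2) by (simp_all add: ab)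
      then have "e \<in> F (nat g)"
        using g pos e ab by (auto simp: F_def image_iff zdiv_int)
      moreover have "nat g \<in> {2..D}" using g \<open>g \<le> D\<close> by auto
      ultimately show ?thesis by blast
    qed
  qed
  then have "card S \<le> card (U \<union> (\<Union>k\<in>{2..D}. F k))"
    by (rule card_mono[rotated]) (use finU in \<open>auto simp: F_def\<close>)
  also have "\<dots> \<le> card U + card (\<Union>k\<in>{2..D}. F k)" by (rule card_Un_le)
  also have "card (\<Union>k\<in>{2..D}. F k) \<le> (\<Sum>k=2..D. card (F k))" by (rule card_UN_le) simp
  also have "\<dots> \<le> (\<Sum>k=2..D. (D div k)\<^sup>2)"
  proof (rule sum_mono)
    fix k
    have "card (F k) \<le> card ({1..int (D div k)} \<times> {1..int (D div k)})"
      unfolding F_def by (rule card_image_le) simp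
    then show "card (F k) \<le> (D div k)\<^sup>2"
      by (simp add: card_cartesian_product power2_eq_square)
  qed
  finally have "real (card S) \<le> real (card U) + (\<Sum>k=2..D. (real (D div k))\<^sup>2)"
    by (metis (mono_tags, lifting) add_left_mono of_nat_add of_nat_le_iff of_nat_power of_nat_sum sum.cong)
  also have "(\<Sum>k=2..D. (real (D div k))\<^sup>2) \<le> (\<Sum>k=2..D. (real D)\<^sup>2 * (1 / (real k)\<^sup>2))"
  proof (rule sum_mono)
    fix k
    have "(real (D div k))\<^sup>2 \<le> (real D / real k)\<^sup>2"
      by (intro power_mono of_nat_div_le_of_nat) simp
    then show "(real (D div k))\<^sup>2 \<le> (real D)\<^sup>2 * (1 / (real k)\<^sup>2)" by (simp add: power_divide)
  qed
  also have "\<dots> \<le> (real D)\<^sup>2 * (3 / 4)"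
    unfolding sum_distrib_left[symmetric]
    by (intro mult_left_mono sum_inverse_squares_le) simp
  finally have "real (D ^ 2) \<le> real (4 * card U)"
    by (simp add: S_def card_cartesian_product power2_eq_square)
  then show ?thesis unfolding U_def of_nat_le_iff .
qed

lemma finite_dirs: "finite (dirs D)"
  by (rule finite_subset[of _ "{1..int D} \<times> {1..int D} \<times> {1..int D}"]) (auto simp: dirs_def)

lemma card_dirs_ge: "D ^ 3 \<le> 4 * card (dirs D)"
proof -
  define U where "U = {(a, b). a \<in> {1..int D} \<and> b \<in> {1..int D} \<and> coprime a b}"
  have "dirs D = (\<lambda>((a, b), c). (a, b, c)) ` (U \<times> {1..int D})"
    by (force simp: dirs_def U_def image_iff)
  moreover have "inj_on (\<lambda>((a, b), c). (a, b, c)) (U \<times> {1..int D})"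
    by (auto simp: inj_on_def)
  ultimately have "card (dirs D) = card U * D"
    by (simp add: card_image card_cartesian_product)
  then show ?thesis
    using mult_le_mono1[OF card_coprime_pairs[of D], of D]
    by (simp add: U_def power3_eq_cube power2_eq_square)
qed

section \<open>Lines of the cube in a fixed direction\<close>

lemma cube_line_base:
  assumes "d \<in> dirs D" "x \<in> cube q"
  shows "\<exists>b. b \<in> cube q \<and> ray d (-1) b \<notin> cube q \<and> same_line d x b"
  using assms(2)
proof (induction "nat (fst x)" arbitrary: x rule: less_induct)
  case less
  show ?case
  proof (cases "ray d (-1) x \<in> cube q")
    case True
    \<comment> \<open>Directions have positive coordinates, so walking backwards must leave the
      cube.\<close>
    have "nat (fst (ray d (-1) x)) < nat (fst x)"
      using \<open>d \<in> dirs D\<close> less.prems True by (cases d; cases x) (auto simp: dirs_def cube_def)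
    from less.hyps[OF this True] obtain b where
      "b \<in> cube q" "ray d (-1) b \<notin> cube q" "same_line d (ray d (-1) x) b" by blast
    moreover have "same_line d x (ray d (-1) x)" by (auto simp: same_line_def)
    ultimately show ?thesis using same_line_trans by blast
  next
    case False
    moreover have "same_line d x x" unfolding same_line_def by (metis ray_0)
    ultimately show ?thesis using less.prems by blast
  qed
qed

text \<open>A backward step subtracts between 1 and \<open>D\<close> from each coordinate, so it
  leaves the cube only if some coordinate is below \<open>D\<close>.\<close>

lemma card_cube_bases:
  assumes "d \<in> dirs D"
  shows "card {b \<in> cube q. ray d (-1) b \<notin> cube q} \<le> 3 * (D * q\<^sup>2)"
proof -
  define I where "I = {0..<int q}"
  define J where "J = {0..<int D}"
  have "{b \<in> cube q. ray d (-1) b \<notin> cube q} \<subseteq> (J \<times> I \<times> I \<union> I \<times> J \<times> I) \<union> I \<times> I \<times> J"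
    using assms by (cases d) (auto simp: cube_def dirs_def I_def J_def)
  then have "card {b \<in> cube q. ray d (-1) b \<notin> cube q}
      \<le> card ((J \<times> I \<times> I \<union> I \<times> J \<times> I) \<union> I \<times> I \<times> J)"
    by (rule card_mono[rotated]) (simp add: I_def J_def)
  also have "\<dots> \<le> card (J \<times> I \<times> I) + card (I \<times> J \<times> I) + card (I \<times> I \<times> J)"
    by (meson add_le_mono card_Un_le order_refl order_trans)
  also have "\<dots> = 3 * (D * q\<^sup>2)"
    by (simp add: card_cartesian_product I_def J_def power2_eq_square)
  finally show ?thesis .
qed

text \<open>Points assigned to the same base lie on one line, so each of the at most
  \<open>3 * (D * q\<^sup>2)\<close> bases serves at most two points of \<open>R\<close>.\<close>

lemma card_two_per_line:
  assumes "d \<in> dirs D" "R \<subseteq> cube q"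
    and two: "\<And>T. T \<subseteq> R \<Longrightarrow> card T = 3 \<Longrightarrow> \<exists>x\<in>T. \<exists>y\<in>T. \<not> same_line d x y"
  shows "card R \<le> 6 * (D * q\<^sup>2)"
proof -
  define B where "B = {b \<in> cube q. ray d (-1) b \<notin> cube q}"
  have finB: "finite B" and finR: "finite R"
    using finite_cube assms(2) by (auto simp: B_def intro: finite_subset)
  have "\<exists>b. b \<in> B \<and> same_line d x b" if "x \<in> R" for x
    using cube_line_base[OF assms(1), of x q] that assms(2) unfolding B_def by blast
  then obtain f where f: "\<And>x. x \<in> R \<Longrightarrow> f x \<in> B \<and> same_line d x (f x)" by metis
  have "R = (\<Union>b\<in>B. {x \<in> R. f x = b})" using f by auto
  then have "card R \<le> (\<Sum>b\<in>B. card {x \<in> R. f x = b})"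
    using card_UN_le[OF finB, of "\<lambda>b. {x \<in> R. f x = b}"] by simp
  also have "\<dots> \<le> (\<Sum>b\<in>B. 2)"
  proof (rule sum_mono, rule ccontr)
    fix b assume "\<not> card {x \<in> R. f x = b} \<le> 2"
    then have "3 \<le> card {x \<in> R. f x = b}" by simp
    then obtain T where T: "T \<subseteq> {x \<in> R. f x = b}" "card T = 3"
      by (rule obtain_subset_with_card_n)
    then have "\<forall>x\<in>T. \<forall>y\<in>T. same_line d x y"
      using f same_line_sym same_line_trans by (smt (verit, ccfv_SIG) mem_Collect_eq subsetD)
    moreover have "T \<subseteq> R" using T by auto
    ultimately show False using two T(2) by blast
  qed
  also have "\<dots> \<le> 6 * (D * q\<^sup>2)"
    using card_cube_bases[OF assms(1), of q] by (simp add: B_def)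
  finally show ?thesis .
qed

definition line_matching :: "lpoint set \<Rightarrow> lpoint \<Rightarrow> lpoint set set \<Rightarrow> bool" where
  "line_matching A d M \<longleftrightarrow>
     (\<forall>T\<in>M. T \<subseteq> A \<and> card T = 3 \<and> (\<forall>x\<in>T. \<forall>y\<in>T. same_line d x y)) \<and> disjoint M"

text \<open>In a maximal matching the uncovered points contain no three on a line of direction
  \<open>d\<close>, since these could be added.\<close>

lemma ex_line_matching:
  assumes "d \<in> dirs D" "A \<subseteq> cube q"
  shows "\<exists>M. line_matching A d M \<and> card (A - \<Union>M) \<le> 6 * (D * q\<^sup>2)"
proof -
  have finA: "finite A" using assms(2) finite_cube by (rule finite_subset)
  have "finite {M. line_matching A d M}"
    by (rule finite_subset[of _ "Pow (Pow A)"]) (use finA in \<open>auto simp: line_matching_def\<close>)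
  moreover have "{} \<in> {M. line_matching A d M}" by (simp add: line_matching_def)
  ultimately obtain M where M: "line_matching A d M"
    and max: "\<And>N. line_matching A d N \<Longrightarrow> M \<subseteq> N \<Longrightarrow> M = N"
    using finite_has_maximal[of "{M. line_matching A d M}"] by auto
  have "\<exists>x\<in>T. \<exists>y\<in>T. \<not> same_line d x y" if T: "T \<subseteq> A - \<Union>M" "card T = 3" for T
  proof (rule ccontr)
    assume "\<not> ?thesis"
    then have "line_matching A d (insert T M)"
      using M T by (auto simp: line_matching_def pairwise_insert disjnt_def)
    then have "T \<in> M" using max[of "insert T M"] by blast
    then have "T = {}" using T(1) by blast
    then show False using T(2) by simp
  qed
  then have "card (A - \<Union>M) \<le> 6 * (D * q\<^sup>2)"
    using assms by (intro card_two_per_line) auto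
  then show ?thesis using M by blast
qed

lemma line_matching_eq:
  assumes "line_matching A d M" "S \<in> M" "T \<in> M" "x \<in> S" "x \<in> T"
  shows "S = T"
  using assms unfolding line_matching_def pairwise_def disjnt_def by blast

lemma card_three_distinct: "card {x, y, z} = 3 \<Longrightarrow> x \<noteq> y \<and> x \<noteq> z \<and> y \<noteq> z"
  by (auto simp: card_insert_if split: if_splits)

lemma line_matching_section:
  assumes M: "line_matching A d M" and x: "x \<in> \<Union>M"
  shows "card {(y, z). {x, y, z} \<in> M} = 2"
proof -
  obtain T where T: "T \<in> M" "x \<in> T" using x by blast
  have "card T = 3" using M T(1) by (simp add: line_matching_def)
  then obtain y z where yz: "T = {x, y, z}" "x \<noteq> y" "x \<noteq> z" "y \<noteq> z"
    using T(2) by (smt (verit) card_3_iff insertE insert_commute singletonD)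
  have "{(y, z). {x, y, z} \<in> M} = {(y, z), (z, y)}"
  proof (rule set_eqI, clarify)
    fix u v
    show "(u, v) \<in> {(y, z). {x, y, z} \<in> M} \<longleftrightarrow> (u, v) \<in> {(y, z), (z, y)}"
    proof
      assume "(u, v) \<in> {(y, z). {x, y, z} \<in> M}"
      then have uv: "{x, u, v} \<in> M" by simp
      then have "insert x {u, v} = insert x {y, z}"
        unfolding yz(1)[symmetric] by (rule line_matching_eq[OF M _ T(1) _ T(2)]) simp
      moreover have "card {x, u, v} = 3" using uv M by (simp only: line_matching_def)
      from card_three_distinct[OF this] have "x \<notin> {u, v}" by simp
      moreover have "x \<notin> {y, z}" using yz by simp
      ultimately have "{u, v} = {y, z}" using insert_ident[of x "{u, v}" "{y, z}"] by blast
      then show "(u, v) \<in> {(y, z), (z, y)}" by (simp only: doubleton_eq_iff) blast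
    next
      assume "(u, v) \<in> {(y, z), (z, y)}"
      then show "(u, v) \<in> {(y, z). {x, y, z} \<in> M}"
        using T(1) yz(1) by (auto simp: insert_commute)
    qed
  qed
  then show ?thesis using yz by simp
qed

text \<open>The hypothesis on \<open>D\<close> lets each direction leave at most half of
  \<open>A\<close> uncovered. A covered point starts exactly two ordered triples per direction, so
  each direction contributes at least \<open>card A\<close> triples and at most 2 to any degree. Two
  distinct points determine the direction and, within it, the matched triple, which gives
  linearity.\<close>

lemma supersaturation:
  assumes A: "A \<subseteq> cube q" and D: "12 * (D * q\<^sup>2) \<le> card A"
  obtains E where "linear_triples A E (2 * card (dirs D))"
    "card A * card (dirs D) \<le> card E"
    "\<And>x y z. (x, y, z) \<in> E \<Longrightarrow> x \<noteq> y \<and> x \<noteq> z \<and> y \<noteq> z \<and> col x y z"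
proof -
  have finA: "finite A" using A finite_cube by (rule finite_subset)
  have "\<forall>d\<in>dirs D. \<exists>M. line_matching A d M \<and> card (A - \<Union>M) \<le> 6 * (D * q\<^sup>2)"
    using ex_line_matching[OF _ A] by blast
  from bchoice[OF this] obtain M where
    M: "\<And>d. d \<in> dirs D \<Longrightarrow> line_matching A d (M d)"
    and rest: "\<And>d. d \<in> dirs D \<Longrightarrow> card (A - \<Union>(M d)) \<le> 6 * (D * q\<^sup>2)" by blast
  define F where "F = (\<lambda>d. {(x, y, z). {x, y, z} \<in> M d})"
  define E where "E = (\<Union>d\<in>dirs D. F d)"
  have memF: "x \<in> A \<and> y \<in> A \<and> z \<in> A \<and> x \<noteq> y \<and> x \<noteq> z \<and> y \<noteq> z
      \<and> same_line d x y \<and> same_line d x z"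
    if "d \<in> dirs D" "(x, y, z) \<in> F d" for d x y z
  proof -
    have "{x, y, z} \<in> M d" using that(2) by (simp add: F_def)
    then have T: "{x, y, z} \<subseteq> A" "card {x, y, z} = 3"
      and same: "\<forall>u\<in>{x, y, z}. \<forall>v\<in>{x, y, z}. same_line d u v"
      using M[OF that(1)] unfolding line_matching_def by metis+
    from same have "same_line d x y" "same_line d x z" by simp_all
    with T card_three_distinct[OF T(2)] show ?thesis by blast
  qed
  have finF: "finite (F d)" if "d \<in> dirs D" for d
    by (rule finite_subset[of _ "A \<times> A \<times> A"]) (use memF[OF that] finA in auto)
  have F_eq: "d = d'" if "d \<in> dirs D" "d' \<in> dirs D" "(x, y, z) \<in> F d" "(x, y, z') \<in> F d'"
    for d d' x y z z'
    using memF[OF that(1,3)] memF[OF that(2,4)] dirs_unique[OF that(1,2)] by blast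
  have cardF: "card A \<le> card (F d)" if d: "d \<in> dirs D" for d
  proof -
    have UN: "\<Union>(M d) \<subseteq> A" using M[OF d] by (auto simp: line_matching_def)
    have fin: "finite {(y, z). {x, y, z} \<in> M d}" for x
      by (rule finite_subset[of _ "A \<times> A"]) (use UN finA in auto)
    have "F d = (SIGMA x:\<Union>(M d). {(y, z). {x, y, z} \<in> M d})" by (auto simp: F_def)
    then have "card (F d) = (\<Sum>x\<in>\<Union>(M d). card {(y, z). {x, y, z} \<in> M d})"
      by (simp only: card_SigmaI[OF finite_subset[OF UN finA] ballI[OF fin]])
    also have "\<dots> = 2 * card (\<Union>(M d))"
      using line_matching_section[OF M[OF d]] by simp
    finally have "card (F d) = 2 * card (\<Union>(M d))" .
    moreover have "card (A - \<Union>(M d)) = card A - card (\<Union>(M d))"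
      using UN finA by (meson card_Diff_subset finite_subset)
    ultimately show ?thesis using rest[OF d] D by linarith
  qed
  show thesis
  proof
    show "linear_triples A E (2 * card (dirs D))"
    proof
      show "finite A" by (rule finA)
      show "E \<subseteq> A \<times> A \<times> A"
      proof
        fix e assume "e \<in> E"
        moreover obtain x y z where "e = (x, y, z)" by (metis prod.exhaust)
        ultimately show "e \<in> A \<times> A \<times> A" using memF unfolding E_def by blast
      qed
      show "(y, x, z) \<in> E" "(x, z, y) \<in> E" if "(x, y, z) \<in> E" for x y z
        using that by (auto simp: E_def F_def insert_commute)
    next
      fix x y z z' assume "(x, y, z) \<in> E" "(x, y, z') \<in> E"
      then obtain d where d: "d \<in> dirs D" "(x, y, z) \<in> F d" "(x, y, z') \<in> F d"
        unfolding E_def using F_eq by blast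
      then have "{x, y, z} = {x, y, z'}"
        using line_matching_eq[OF M[OF d(1)], of _ _ x] by (simp add: F_def)
      then show "z = z'" using memF[OF d(1,2)] memF[OF d(1,3)] by auto
    next
      fix x
      have "{(y, z). (x, y, z) \<in> E} = (\<Union>d\<in>dirs D. {(y, z). {x, y, z} \<in> M d})"
        by (auto simp: E_def F_def)
      also have "card \<dots> \<le> (\<Sum>d\<in>dirs D. card {(y, z). {x, y, z} \<in> M d})"
        by (rule card_UN_le[OF finite_dirs])
      also have "\<dots> \<le> (\<Sum>d\<in>dirs D. 2)"
      proof (rule sum_mono)
        fix d assume d: "d \<in> dirs D"
        show "card {(y, z). {x, y, z} \<in> M d} \<le> 2"
        proof (cases "x \<in> \<Union>(M d)")
          case True
          then show ?thesis using line_matching_section[OF M[OF d]] by simp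
        next
          case False
          then have "{(y, z). {x, y, z} \<in> M d} = {}" by auto
          then show ?thesis by (metis card.empty zero_le)
        qed
      qed
      finally show "card {(y, z). (x, y, z) \<in> E} \<le> 2 * card (dirs D)" by simp
    qed
    have "card A * card (dirs D) = (\<Sum>d\<in>dirs D. card A)" by simp
    also have "\<dots> \<le> (\<Sum>d\<in>dirs D. card (F d))" by (intro sum_mono cardF)
    also have "\<dots> = card E"
      unfolding E_def
    proof (rule card_UN_disjoint[symmetric])
      show "\<forall>d\<in>dirs D. \<forall>d'\<in>dirs D. d \<noteq> d' \<longrightarrow> F d \<inter> F d' = {}"
      proof (intro ballI impI equals0I)
        fix d d' e assume d: "d \<in> dirs D" "d' \<in> dirs D" "d \<noteq> d'" "e \<in> F d \<inter> F d'"
        moreover obtain x y z where "e = (x, y, z)" by (metis prod.exhaust)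
        ultimately show False using F_eq[of d d' x y z z] by blast
      qed
    qed (use finite_dirs finF in blast)+
    finally show "card A * card (dirs D) \<le> card E" .
    show "x \<noteq> y \<and> x \<noteq> z \<and> y \<noteq> z \<and> col x y z" if "(x, y, z) \<in> E" for x y z
      using that memF same_line_col unfolding E_def by blast
  qed
qed

section \<open>Containers in the cube\<close>

text \<open>The two constraints on \<open>K\<close> ask for about \<open>a * r / \<Delta>\<close>
  and \<open>a / r\<close>, which balance at \<open>r\<close> near \<open>sqrt \<Delta>\<close>. As
  \<open>\<Delta>\<close> has order at least \<open>a ^ 3 / p ^ 18\<close>, the cost
  \<open>a / sqrt \<Delta>\<close> is of order at most \<open>p ^ 9 / sqrt a\<close>, that is
  \<open>p ^ 5\<close> once \<open>a\<close> exceeds \<open>p ^ 8\<close>.\<close>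

lemma lattice_containers_step:
  assumes A: "A \<subseteq> cube (p ^ 3)" and big: "p ^ 8 < card A" and p: "4 \<le> p"
  shows "\<exists>\<C>. covering no_three_col A \<C> \<and> card \<C> \<le> (p ^ 9 + 1) ^ (2 * (6000 * p ^ 5))
    \<and> (\<forall>C\<in>\<C>. real (card C) \<le> 63 / 64 * card A)"
proof -
  define a where "a = card A"
  define D where "D = a div (12 * p ^ 6)"
  define \<Delta> where "\<Delta> = 2 * card (dirs D)"
  define r where "r = nat \<lceil>sqrt \<Delta>\<rceil>"
  define K where "K = 6000 * p ^ 5"
  \<comment> \<open>\<open>4 \<le> p\<close> gives \<open>12 \<le> p\<^sup>2\<close>; this ensures
    \<open>1 \<le> D\<close>.\<close>
  have "12 * p ^ 6 \<le> p\<^sup>2 * p ^ 6"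
    using power_mono[OF p, of 2] by (intro mult_right_mono) auto
  also have "\<dots> = p ^ 8" by (simp flip: power_add)
  finally have a12: "12 * p ^ 6 \<le> a" using big by (simp add: a_def)
  have p_pos: "0 < p" using p by simp
  have "12 * (D * (p ^ 3)\<^sup>2) = D * (12 * p ^ 6)" by (simp flip: power_mult)
  also have "\<dots> \<le> a" unfolding D_def by (rule div_times_less_eq_dividend)
  finally obtain E where E: "linear_triples A E \<Delta>" "card A * card (dirs D) \<le> card E"
    and colE: "\<And>x y z. (x, y, z) \<in> E \<Longrightarrow> x \<noteq> y \<and> x \<noteq> z \<and> y \<noteq> z \<and> col x y z"
    using supersaturation[OF A, of D] unfolding a_def \<Delta>_def by blast
  interpret linear_triples A E \<Delta> by (rule E(1))

  have "1 \<le> D" using a12 p_pos unfolding D_def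
    by (metis One_nat_def Suc_leI div_greater_zero_iff mult_pos_pos zero_less_numeral zero_less_power)
  have "a < (D + 1) * (12 * p ^ 6)"
    using p_pos unfolding D_def by (simp add: dividend_less_div_times)
  also have "\<dots> \<le> (2 * D) * (12 * p ^ 6)" using \<open>1 \<le> D\<close> by (intro mult_right_mono) auto
  finally have "a \<le> 24 * D * p ^ 6" by simp
  then have "a ^ 3 \<le> (24 * D * p ^ 6) ^ 3" by (rule power_mono) simp
  also have "\<dots> = 13824 * (D ^ 3 * p ^ 18)" by (simp add: power_mult_distrib flip: power_mult)
  also have "\<dots> \<le> 13824 * (4 * card (dirs D) * p ^ 18)"
    by (intro mult_left_mono mult_right_mono card_dirs_ge) auto
  finally have a3: "a ^ 3 \<le> 27648 * (\<Delta> * p ^ 18)" by (simp add: \<Delta>_def)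
  have "\<Delta> > 0" using a3 a12 p_pos by (cases \<Delta>) auto

  \<comment> \<open>The lower bound on \<open>a\<close> enters here. The 1024 is the square of the
    32 in \<open>K2\<close>, and 6000 is chosen so that its square exceeds 27648 times 1024.\<close>
  have "(a\<^sup>2 * p ^ 8) * 1024 \<le> a ^ 3 * 1024"
    using big by (intro mult_right_mono) (auto simp: a_def power3_eq_cube power2_eq_square)
  also have "\<dots> \<le> 27648 * (\<Delta> * p ^ 18) * 1024" using a3 by (rule mult_right_mono) simp
  also have "\<dots> < (6000\<^sup>2 * \<Delta> * p ^ 10) * p ^ 8"
    using \<open>\<Delta> > 0\<close> p_pos by (simp add: mult.assoc flip: power_add)
  finally have "(1024 * a\<^sup>2) * p ^ 8 < (6000\<^sup>2 * \<Delta> * p ^ 10) * p ^ 8" by (simp only: ac_simps)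
  then have "1024 * a\<^sup>2 < 6000\<^sup>2 * \<Delta> * p ^ 10" by simp
  also have "\<dots> = K\<^sup>2 * \<Delta>" by (simp add: K_def power_mult_distrib flip: power_mult)
  finally have "(32 * a)\<^sup>2 < K\<^sup>2 * \<Delta>" by (simp add: power_mult_distrib)
  then have "real ((32 * a)\<^sup>2) < real (K\<^sup>2 * \<Delta>)" by (simp only: of_nat_less_iff)
  then have "(32 * real a)\<^sup>2 < (real K * sqrt \<Delta>)\<^sup>2"
    by (simp add: power_mult_distrib)
  then have sqK: "32 * real a < real K * sqrt \<Delta>"
    by (rule power_less_imp_less_base) simp
  have sq1: "1 \<le> sqrt \<Delta>" using \<open>\<Delta> > 0\<close> by simp
  have r: "sqrt \<Delta> \<le> r" "r \<le> sqrt \<Delta> + 1"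
    unfolding r_def using sq1 by linarith+
  have "sqrt \<Delta> \<le> sqrt (\<Delta> * \<Delta>)" using \<open>\<Delta> > 0\<close> by (intro real_sqrt_le_mono) simp
  then have "sqrt \<Delta> \<le> \<Delta>" by simp
  then have "\<lceil>sqrt \<Delta>\<rceil> \<le> int \<Delta>" by (simp add: ceiling_le_iff)
  then have "r \<le> \<Delta>" unfolding r_def by (simp only: nat_le_iff)
  have "real K * sqrt \<Delta> \<le> real K * real r" using r by (intro mult_left_mono) auto
  then have "real (32 * a) < real (K * r)" using sqK by simp
  then have K2: "32 * card A < K * r" unfolding of_nat_less_iff a_def .
  have "real a * real r \<le> real a * (2 * sqrt \<Delta>)"
    by (rule mult_left_mono) (use r sq1 in linarith, simp)
  then have "real (8 * (a * r)) \<le> 8 * (real a * (2 * sqrt \<Delta>))" by simp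
  also have "\<dots> \<le> (32 * real a) * sqrt \<Delta>" by simp
  also have "\<dots> < (real K * sqrt \<Delta>) * sqrt \<Delta>"
    using sqK sq1 by (intro mult_strict_right_mono) auto
  also have "\<dots> = real (K * \<Delta>)" by simp
  finally have K1: "8 * (card A * r) < K * \<Delta>" unfolding of_nat_less_iff a_def .
  have "card A * \<Delta> \<le> 2 * card E" using E(2) by (simp add: \<Delta>_def)
  then obtain \<C> where C: "covering indep A \<C>" "card \<C> \<le> (card A + 1) ^ (2 * K)"
    "\<And>C. C \<in> \<C> \<Longrightarrow> 64 * card C \<le> 63 * card A"
    using containers[OF _ \<open>r \<le> \<Delta>\<close> K1 K2] by blast
  have "indep I" if "no_three_col I" for I
    using that colE unfolding indep_def no_three_col_def by blast
  then have "covering no_three_col A \<C>" using C(1) by (simp add: covering_def)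
  moreover have "card A \<le> p ^ 9"
    using card_mono[OF finite_cube A] by (simp add: card_cube flip: power_mult)
  then have "(card A + 1) ^ (2 * K) \<le> (p ^ 9 + 1) ^ (2 * K)" by (intro power_mono) auto
  moreover have "real (card C) \<le> 63 / 64 * card A" if "C \<in> \<C>" for C
    using C(3)[OF that] by linarith
  ultimately show ?thesis using C(2) unfolding K_def by (meson order_trans)
qed

lemma lattice_containers:
  assumes p: "4 \<le> p"
  obtains \<C> where "covering no_three_col (cube (p ^ 3)) \<C>" "\<And>C. C \<in> \<C> \<Longrightarrow> card C \<le> p ^ 8"
    "ln (real (card \<C>)) \<le> 120000 * real p ^ 5 * ln p * (64 * ln p + 1)"
proof -
  define N where "N = (p ^ 9 + 1) ^ (2 * (6000 * p ^ 5))"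
  \<comment> \<open>Enough rounds for \<open>(63 / 64) ^ k\<close> to fall below
    \<open>1 / p\<close>, which brings the \<open>p ^ 9\<close> points of the cube down to
    \<open>p ^ 8\<close>.\<close>
  define k where "k = nat \<lceil>64 * ln (real p)\<rceil>"
  have lnp: "0 < ln (real p)" using p by simp
  have "\<exists>\<C>. covering no_three_col (cube (p ^ 3)) \<C> \<and> card \<C> \<le> N ^ k
    \<and> (\<forall>C\<in>\<C>. card C \<le> p ^ 8 \<or> real (card C) \<le> (63 / 64) ^ k * card (cube (p ^ 3)))"
    by (rule iterate_containers[OF finite_cube])
      (use lattice_containers_step[OF _ _ p] in \<open>auto simp: N_def\<close>)
  then obtain \<C> where C: "covering no_three_col (cube (p ^ 3)) \<C>" "card \<C> \<le> N ^ k"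
    and size: "\<And>C. C \<in> \<C> \<Longrightarrow> card C \<le> p ^ 8 \<or> real (card C) \<le> (63 / 64) ^ k * card (cube (p ^ 3))"
    by blast
  have k: "64 * ln p \<le> k" "k \<le> 64 * ln p + 1" unfolding k_def using lnp by linarith+
  have "(63 / 64 :: real) ^ k \<le> exp (- (1 / 64)) ^ k"
    using exp_ge_add_one_self[of "- (1 / 64)"] by (intro power_mono) auto
  also have "\<dots> = exp (- (real k / 64))" by (simp flip: exp_of_nat_mult)
  also have "\<dots> \<le> exp (- ln p)" using k by simp
  also have "\<dots> = 1 / p" using p by (simp add: exp_minus inverse_eq_divide)
  finally have pw: "(63 / 64 :: real) ^ k \<le> 1 / p" .
  have "(63 / 64) ^ k * real (card (cube (p ^ 3))) \<le> 1 / p * p ^ 9"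
    using mult_right_mono[OF pw, of "real p ^ 9"] by (simp add: card_cube flip: power_mult)
  also have "\<dots> = real (p ^ 8)" using p by (simp add: power_eq_if)
  finally have small: "(63 / 64) ^ k * real (card (cube (p ^ 3))) \<le> real (p ^ 8)" .
  have "no_three_col {}" by (simp add: no_three_col_def)
  then have "\<C> \<noteq> {}" using C(1) by (auto simp: covering_def)
  then have pos: "0 < card \<C>" using covering_finite[OF C(1)] by (simp add: card_gt_0_iff)
  have "p ^ 9 + 1 \<le> p ^ 10"
  proof -
    have "p ^ 9 + 1 \<le> 2 * p ^ 9" using p by simp
    also have "\<dots> \<le> p * p ^ 9" using p by (intro mult_right_mono) auto
    finally show ?thesis by (simp add: power_eq_if)
  qed
  then have "N ^ k \<le> ((p ^ 10) ^ (2 * (6000 * p ^ 5))) ^ k"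
    unfolding N_def by (intro power_mono) auto
  also have "\<dots> = p ^ (120000 * p ^ 5 * k)"
    by (simp flip: power_mult)
  finally have "card \<C> \<le> p ^ (120000 * p ^ 5 * k)" using C(2) by linarith
  then have "real (card \<C>) \<le> real p ^ (120000 * p ^ 5 * k)"
    by (metis of_nat_le_iff of_nat_power)
  then have "ln (real (card \<C>)) \<le> ln (real p ^ (120000 * p ^ 5 * k))"
    using pos p by (subst ln_le_cancel_iff) auto
  also have "\<dots> = 120000 * real p ^ 5 * ln p * k"
    using p by (simp add: ln_realpow)
  also have "\<dots> \<le> 120000 * real p ^ 5 * ln p * (64 * ln p + 1)"
    using k lnp by (intro mult_left_mono) auto
  finally have "ln (real (card \<C>)) \<le> 120000 * real p ^ 5 * ln p * (64 * ln p + 1)" .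
  moreover have "card C \<le> p ^ 8" if "C \<in> \<C>" for C
    using size[OF that] small by linarith
  ultimately show thesis using that C(1) by blast
qed

section \<open>Collinear quadruples\<close>

definition collinear_quads :: "nat \<Rightarrow> lpoint set set" where
  "collinear_quads q =
     {T. T \<subseteq> cube q \<and> card T = 4 \<and> (\<forall>x\<in>T. \<forall>y\<in>T. \<forall>z\<in>T. col x y z)}"

lemma finite_collinear_quads: "finite (collinear_quads q)"
  by (rule finite_subset[of _ "Pow (cube q)"]) (auto simp: collinear_quads_def finite_cube)

text \<open>Dividing \<open>y - x\<close> by the gcd of its coordinates yields a direction for which
  all lattice points of the line are integral multiples away from \<open>x\<close>.\<close>

lemma col_primitive_direction:
  assumes "x \<noteq> y"
  obtains d where "d \<noteq> (0, 0, 0)" "\<And>z. col x y z \<Longrightarrow> same_line d x z"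
proof -
  obtain x1 x2 x3 y1 y2 y3 where xy: "x = (x1, x2, x3)" "y = (y1, y2, y3)"
    by (metis prod.exhaust)
  define w1 w2 w3 where w: "w1 = y1 - x1" "w2 = y2 - x2" "w3 = y3 - x3"
  define g where "g = gcd w1 (gcd w2 w3)"
  have "g \<noteq> 0" using assms by (auto simp: g_def w xy)
  have "g dvd w1" "g dvd w2" "g dvd w3" by (auto simp: g_def intro: dvd_trans)
  then obtain d1 d2 d3 where d: "w1 = g * d1" "w2 = g * d2" "w3 = g * d3" by (elim dvdE)
  obtain u v where uv: "u * w2 + v * w3 = gcd w2 w3" using bezout_int by blast
  obtain s t where st: "s * w1 + t * gcd w2 w3 = g" using bezout_int g_def by blast
  have "s * w1 + (t * u) * w2 + (t * v) * w3 = g"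
    using st uv[symmetric] by (simp add: algebra_simps)
  then have "g * (s * d1 + (t * u) * d2 + (t * v) * d3) = g * 1"
    by (simp add: d algebra_simps)
  then obtain \<alpha> \<beta> \<gamma> where one: "\<alpha> * d1 + \<beta> * d2 + \<gamma> * d3 = 1"
    using \<open>g \<noteq> 0\<close> mult_cancel_left by metis
  show thesis
  proof (rule that[of "(d1, d2, d3)"])
    show "(d1, d2, d3) \<noteq> (0, 0, 0)" using one by auto
    fix z assume col: "col x y z"
    obtain z1 z2 z3 where z: "z = (z1, z2, z3)" by (cases z)
    define e1 e2 e3 where e: "e1 = z1 - x1" "e2 = z2 - x2" "e3 = z3 - x3"
    have "g * (d1 * e2) = g * (d2 * e1)" "g * (d1 * e3) = g * (d3 * e1)" "g * (d2 * e3) = g * (d3 * e2)"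
      using col unfolding xy z col.simps
      by (simp_all only: w(1)[symmetric] w(2)[symmetric] w(3)[symmetric]
          e(1)[symmetric] e(2)[symmetric] e(3)[symmetric] d mult.assoc)
    then have eq: "d1 * e2 = d2 * e1" "d1 * e3 = d3 * e1" "d2 * e3 = d3 * e2"
      using \<open>g \<noteq> 0\<close> by simp_all
    \<comment> \<open>The Bezout combination of \<open>d\<close> equals 1, so applied to the
      parallel vector \<open>e\<close> it reads off the multiplier, which is therefore an
      integer.\<close>
    define k where "k = \<alpha> * e1 + \<beta> * e2 + \<gamma> * e3"
    have "k * d1 = (\<alpha> * d1 + \<beta> * d2 + \<gamma> * d3) * e1"
      "k * d2 = (\<alpha> * d1 + \<beta> * d2 + \<gamma> * d3) * e2"
      "k * d3 = (\<alpha> * d1 + \<beta> * d2 + \<gamma> * d3) * e3"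
      unfolding k_def using eq by algebra+
    then have "z = ray (d1, d2, d3) k x" using one by (simp add: xy z e)
    then show "same_line (d1, d2, d3) x z" by (auto simp: same_line_def)
  qed
qed

text \<open>A quadruple is coded by one extreme point \<open>x\<close>, the direction, the distance
  \<open>k\<close> to the other extreme in units of \<open>d\<close>, and the positions
  \<open>i\<close>, \<open>j\<close> of the inner points. As both extremes lie in the cube, the
  coordinates of \<open>d\<close> are at most \<open>q div k\<close> in absolute value.\<close>

lemma collinear_quads_subset:
  "collinear_quads q \<subseteq> (\<Union>k\<in>{1..q}. (\<lambda>(x, d, i, j). {x, ray d i x, ray d j x, ray d (int k) x}) `
     (cube q \<times> ({- int (q div k)..int (q div k)} \<times> {- int (q div k)..int (q div k)}
        \<times> {- int (q div k)..int (q div k)}) \<times> {1..int k} \<times> {1..int k}))"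
proof
  fix T assume "T \<in> collinear_quads q"
  then have T: "T \<subseteq> cube q" "card T = 4" "\<And>x y z. x \<in> T \<Longrightarrow> y \<in> T \<Longrightarrow> z \<in> T \<Longrightarrow> col x y z"
    by (auto simp: collinear_quads_def)
  have finT: "finite T" using T(2) card.infinite by fastforce
  have "2 \<le> card T" using T(2) by simp
  then obtain U where "U \<subseteq> T" "card U = 2" by (rule obtain_subset_with_card_n)
  then obtain x0 y0 where xy: "x0 \<in> T" "y0 \<in> T" "x0 \<noteq> y0" by (auto simp: card_2_iff)
  obtain d where d: "d \<noteq> (0, 0, 0)" "\<And>z. col x0 y0 z \<Longrightarrow> same_line d x0 z"
    using col_primitive_direction[OF xy(3)] by blast
  have inj: "inj (\<lambda>k. ray d k x0)"
    using d(1) by (cases d; cases x0) (auto simp: inj_def)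
  define S where "S = {k. ray d k x0 \<in> T}"
  have T_eq: "T = (\<lambda>k. ray d k x0) ` S"
    using T(3)[OF xy(1,2)] d(2) by (fastforce simp: S_def same_line_def)
  then have cardS: "card S = 4" using T(2) inj by (metis card_image inj_on_subset subset_UNIV)
  then have finS: "finite S" using card.infinite by fastforce
  have neS: "S \<noteq> {}" using cardS by auto
  define a where "a = Min S"
  define b where "b = Max S"
  have ab: "a \<in> S" "b \<in> S" "\<And>s. s \<in> S \<Longrightarrow> a \<le> s \<and> s \<le> b"
    using finS neS by (auto simp: a_def b_def)
  have "a \<noteq> b"
  proof
    assume "a = b"
    then have "S \<subseteq> {a}" using ab(3) by force
    then show False using cardS card_mono[of "{a}" S] by simp
  qed
  then have "card (S - {a, b}) = 2" using ab cardS finS by (simp add: card_Diff_subset)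
  then obtain i j where ij: "S - {a, b} = {i, j}" by (auto simp: card_2_iff)
  then have S_eq: "S = {a, i, j, b}" using ab by blast
  have mem: "i \<in> S" "j \<in> S" "i \<noteq> a" "j \<noteq> a" using ij by blast+
  define x where "x = ray d a x0"
  define k where "k = nat (b - a)"
  have k: "int k = b - a" "0 < k" 
    using ab(3)[OF ab(1)] \<open>a \<noteq> b\<close> by (auto simp: k_def)
  have T_ray: "T = {x, ray d (i - a) x, ray d (j - a) x, ray d (int k) x}"
    unfolding T_eq S_eq x_def ray_ray k by simp
  have x: "x \<in> cube q" "ray d (int k) x \<in> cube q"
    using ab T(1) by (auto simp: S_def x_def ray_ray k)
  have ij_range: "i - a \<in> {1..int k}" "j - a \<in> {1..int k}"
    using ab(3)[OF mem(1)] ab(3)[OF mem(2)] mem k by auto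
  obtain d1 d2 d3 where d123: "d = (d1, d2, d3)" by (cases d)
  \<comment> \<open>The second conjunct, applied to a nonzero coordinate of \<open>d\<close>, bounds
    the range of \<open>k\<close>.\<close>
  have bound: "\<bar>e\<bar> \<le> int (q div k) \<and> (e \<noteq> 0 \<longrightarrow> k \<le> q)"
    if "0 \<le> u" "u < int q" "0 \<le> u + int k * e" "u + int k * e < int q" for u e :: int
  proof -
    have "int k * \<bar>e\<bar> = \<bar>int k * e\<bar>" by (simp add: abs_mult)
    also have "\<dots> \<le> int q" using that by linarith
    finally have ke: "int k * \<bar>e\<bar> \<le> int q" .
    then have "\<bar>e\<bar> \<le> int q div int k"
      using zdiv_mono1[OF ke, of "int k"] k(2) by simp
    moreover have "int k * 1 \<le> int k * \<bar>e\<bar>" if "e \<noteq> 0" using that by (intro mult_left_mono) auto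
    ultimately show ?thesis using ke by (auto simp: zdiv_int)
  qed
  have d_range: "d \<in> {- int (q div k)..int (q div k)} \<times> {- int (q div k)..int (q div k)}
      \<times> {- int (q div k)..int (q div k)} \<and> k \<le> q"
  proof -
    obtain x1 x2 x3 where x123: "x = (x1, x2, x3)" by (cases x)
    have d_le: "\<bar>d1\<bar> \<le> int (q div k) \<and> (d1 \<noteq> 0 \<longrightarrow> k \<le> q)" "\<bar>d2\<bar> \<le> int (q div k) \<and> (d2 \<noteq> 0 \<longrightarrow> k \<le> q)"
      "\<bar>d3\<bar> \<le> int (q div k) \<and> (d3 \<noteq> 0 \<longrightarrow> k \<le> q)"
      by (rule bound[of x1 d1] bound[of x2 d2] bound[of x3 d3];
          use x in \<open>simp add: cube_def d123 x123\<close>)+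
    have range: "e \<in> {- s..s}" if "\<bar>e\<bar> \<le> s" for e s :: int using that by auto
    have "d1 \<noteq> 0 \<or> d2 \<noteq> 0 \<or> d3 \<noteq> 0" using d(1) by (simp add: d123)
    then have "k \<le> q" using d_le by blast
    then show ?thesis using d_le range unfolding d123 mem_Sigma_iff by blast
  qed
  show "T \<in> (\<Union>k\<in>{1..q}. (\<lambda>(x, d, i, j). {x, ray d i x, ray d j x, ray d (int k) x}) `
     (cube q \<times> ({- int (q div k)..int (q div k)} \<times> {- int (q div k)..int (q div k)}
        \<times> {- int (q div k)..int (q div k)}) \<times> {1..int k} \<times> {1..int k}))"
  proof (intro UN_I[of k] image_eqI[of _ _ "(x, d, i - a, j - a)"])
    show "k \<in> {1..q}" using k(2) d_range by simp
    show "T = (case (x, d, i - a, j - a) of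
        (x, d, i, j) \<Rightarrow> {x, ray d i x, ray d j x, ray d (int k) x})" by (simp only: T_ray prod.case)
  qed (use x(1) ij_range d_range in \<open>simp only: mem_Sigma_iff\<close>)
qed

text \<open>For fixed \<open>k\<close> there are \<open>q ^ 3\<close> start points, at most
  \<open>(3 * q / k) ^ 3\<close> directions as \<open>k \<le> q\<close>, and
  \<open>k\<^sup>2\<close> inner positions. The product is \<open>27 * q ^ 6 / k\<close>, and the
  sum over \<open>k\<close> is harmonic.\<close>

lemma card_collinear_quads: "real (card (collinear_quads q)) \<le> 27 * real q ^ 6 * harm q"
proof -
  define I where "I = (\<lambda>k. {- int (q div k)..int (q div k)})"
  define F where "F = (\<lambda>k. (\<lambda>(x, d, i, j). {x, ray d i x, ray d j x, ray d (int k) x}) `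
     (cube q \<times> (I k \<times> I k \<times> I k) \<times> {1..int k} \<times> {1..int k}))"
  have fin: "finite (cube q \<times> (I k \<times> I k \<times> I k) \<times> {1..int k} \<times> {1..int k})" for k
    by (simp add: I_def finite_cube)
  have cardF: "real (card (F k)) \<le> 27 * real q ^ 6 * inverse (real k)" if k: "k \<in> {1..q}" for k
  proof -
    have "card (F k) \<le> card (cube q \<times> (I k \<times> I k \<times> I k) \<times> {1..int k} \<times> {1..int k})"
      unfolding F_def by (rule card_image_le[OF fin])
    also have "\<dots> = q ^ 3 * (1 + 2 * (q div k)) ^ 3 * k\<^sup>2"
      by (simp add: card_cartesian_product card_cube I_def power3_eq_cube power2_eq_square
          nat_add_distrib nat_mult_distrib algebra_simps)
    finally have "real (card (F k)) \<le> real (q ^ 3 * (1 + 2 * (q div k)) ^ 3 * k\<^sup>2)"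
      by (simp only: of_nat_le_iff)
    also have "\<dots> = real q ^ 3 * (1 + 2 * real (q div k)) ^ 3 * (real k)\<^sup>2" by simp
    also have "\<dots> \<le> real q ^ 3 * (3 * (real q / real k)) ^ 3 * (real k)\<^sup>2"
    proof (intro mult_left_mono mult_right_mono power_mono)
      have "real (q div k) \<le> real q / real k" by (rule of_nat_div_le_of_nat)
      moreover have "1 \<le> real q / real k" using k by (simp add: field_simps)
      ultimately show "1 + 2 * real (q div k) \<le> 3 * (real q / real k)" by linarith
    qed auto
    also have "\<dots> = 27 * real q ^ 6 * inverse (real k)"
      using k by (simp add: field_simps power3_eq_cube power2_eq_square power_eq_if)
    finally show ?thesis .
  qed
  have "card (collinear_quads q) \<le> card (\<Union>k\<in>{1..q}. F k)"
    using collinear_quads_subset[of q] fin unfolding F_def I_def by (intro card_mono) auto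
  also have "\<dots> \<le> (\<Sum>k=1..q. card (F k))" by (rule card_UN_le) simp
  finally have "real (card (collinear_quads q)) \<le> (\<Sum>k=1..q. real (card (F k)))"
    by (metis of_nat_le_iff of_nat_sum)
  also have "\<dots> \<le> (\<Sum>k=1..q. 27 * real q ^ 6 * inverse (real k))"
    by (intro sum_mono cardF)
  also have "\<dots> = 27 * real q ^ 6 * harm q" by (simp add: harm_def sum_distrib_left)
  finally show ?thesis .
qed

section \<open>The random subset of the cube\<close>

text \<open>A uniformly random \<open>M\<close>-subset contains \<open>T\<close> with probability
  the product of \<open>(M - i) / (v - i)\<close> over \<open>i < card T\<close>, and each factor is
  at most \<open>M / v\<close>.\<close>

lemma card_supersets_le:
  assumes "finite V" "T \<subseteq> V" "M \<le> card V" "0 < card V"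
  shows "real (card {S. S \<subseteq> V \<and> card S = M \<and> T \<subseteq> S})
    \<le> (real M / real (card V)) ^ card T * real (card V choose M)"
proof (cases "card T \<le> M")
  case True
  define v where "v = card V"
  have finT: "finite T" using assms(1,2) by (rule finite_subset[rotated])
  have "card {S. S \<subseteq> V \<and> card S = M \<and> T \<subseteq> S}
      \<le> card {S. S \<subseteq> V - T \<and> card S = M - card T}"
  proof (rule card_inj_on_le[of "\<lambda>S. S - T"])
    show "inj_on (\<lambda>S. S - T) {S. S \<subseteq> V \<and> card S = M \<and> T \<subseteq> S}"
      by (rule inj_onI) blast
    show "(\<lambda>S. S - T) ` {S. S \<subseteq> V \<and> card S = M \<and> T \<subseteq> S}
        \<subseteq> {S. S \<subseteq> V - T \<and> card S = M - card T}"
      using finT by (auto simp: card_Diff_subset)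
    show "finite {S. S \<subseteq> V - T \<and> card S = M - card T}" using assms(1) by simp
  qed
  also have "\<dots> = (v - card T) choose (M - card T)"
    using assms(1,2) finT by (simp add: n_subsets card_Diff_subset v_def)
  finally have le: "card {S. S \<subseteq> V \<and> card S = M \<and> T \<subseteq> S} \<le> (v - card T) choose (M - card T)" .
  have "real ((v - k) choose (M - k)) \<le> (real M / real v) ^ k * real (v choose M)"
    if "k \<le> M" for k
    using that
  proof (induction k)
    case (Suc k)
    have kM: "k < M" "M \<le> v" using Suc.prems assms(3) by (auto simp: v_def)
    have "(M - k) * ((v - k) choose (M - k)) = (v - k) * ((v - k - 1) choose (M - k - 1))"
      using kM by (intro times_binomial_minus1_eq) simp
    then have "real (M - k) * real ((v - k) choose (M - k))
        = real (v - k) * real ((v - Suc k) choose (M - Suc k))"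
      by (metis (no_types, lifting) Suc_eq_plus1 diff_diff_left of_nat_mult)
    then have "real ((v - Suc k) choose (M - Suc k))
        = real (M - k) / real (v - k) * real ((v - k) choose (M - k))"
      using kM by (simp add: field_simps)
    also have "\<dots> \<le> real M / real v * real ((v - k) choose (M - k))"
    proof (rule mult_right_mono)
      have "real k * real M \<le> real k * real v" using kM by (intro mult_left_mono) auto
      then have "(real M - real k) * real v \<le> real M * (real v - real k)"
        by (simp add: algebra_simps)
      then show "real (M - k) / real (v - k) \<le> real M / real v"
        using kM by (simp add: of_nat_diff divide_le_eq le_divide_eq field_simps)
    qed simp
    also have "\<dots> \<le> real M / real v * ((real M / real v) ^ k * real (v choose M))"
      using Suc by (intro mult_left_mono) auto
    finally show ?case by simp
  qed simp
  from this[OF True] le show ?thesis unfolding v_def by linarith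
next
  case False
  have "{S. S \<subseteq> V \<and> card S = M \<and> T \<subseteq> S} = {}"
    using False card_mono finite_subset[OF _ assms(1)] by auto
  then show ?thesis by (simp only: card.empty) simp
qed

text \<open>First moments by counting: by Markov's inequality at most half of the
  \<open>M\<close>-subsets contain more than \<open>n\<close> members of \<open>Q\<close>, and by
  the union bound fewer than half contain a member of \<open>B\<close>.\<close>

lemma ex_subset_few_quads_no_bad:
  assumes V: "finite V" "0 < card V" "M \<le> card V"
    and Q: "finite Q" "\<And>T. T \<in> Q \<Longrightarrow> T \<subseteq> V \<and> card T = 4"
    and B: "finite B" "\<And>I. I \<in> B \<Longrightarrow> I \<subseteq> V \<and> card I = m"
    and few: "2 * (real (card Q) * (real M / card V) ^ 4) \<le> real n"
    and rare: "real (card B) * (real M / card V) ^ m < 1 / 2"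
  shows "\<exists>S\<subseteq>V. card S = M \<and> card {T \<in> Q. T \<subseteq> S} \<le> n \<and> (\<forall>I\<in>B. \<not> I \<subseteq> S)"
proof (rule ccontr)
  assume neg: "\<not> ?thesis"
  define \<Omega> where "\<Omega> = {S. S \<subseteq> V \<and> card S = M}"
  define N where "N = real (card V choose M)"
  have fin: "finite \<Omega>" using V(1) by (simp add: \<Omega>_def)
  have N: "real (card \<Omega>) = N" "0 < N"
    using V by (auto simp: N_def \<Omega>_def n_subsets zero_less_binomial_iff)
  have sup: "real (card {S \<in> \<Omega>. T \<subseteq> S}) \<le> (real M / card V) ^ card T * N" if "T \<subseteq> V" for T
    using card_supersets_le[OF V(1) that V(3,2)] by (simp add: \<Omega>_def N_def conj_ac)
  define X where "X = {S \<in> \<Omega>. n < card {T \<in> Q. T \<subseteq> S}}"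
  define Y where "Y = (\<Union>I\<in>B. {S \<in> \<Omega>. I \<subseteq> S})"
  have finX: "finite X" and finY: "finite Y"
    using fin B(1) by (auto simp: X_def Y_def)
  have "(real n + 1) * real (card X) = (\<Sum>S\<in>X. real n + 1)" by simp
  also have "\<dots> \<le> (\<Sum>S\<in>X. real (card {T \<in> Q. T \<subseteq> S}))"
    by (intro sum_mono) (auto simp: X_def)
  also have "\<dots> \<le> (\<Sum>S\<in>\<Omega>. real (card {T \<in> Q. T \<subseteq> S}))"
    using fin by (intro sum_mono2) (auto simp: X_def)
  also have "\<dots> = (\<Sum>S\<in>\<Omega>. \<Sum>T\<in>Q. if T \<subseteq> S then 1 else 0)"
    using Q(1) by (simp add: sum.If_cases Int_def)
  also have "\<dots> = (\<Sum>T\<in>Q. \<Sum>S\<in>\<Omega>. if T \<subseteq> S then 1 else 0)" by (rule sum.swap)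
  also have "\<dots> = (\<Sum>T\<in>Q. real (card {S \<in> \<Omega>. T \<subseteq> S}))"
    using fin by (simp add: sum.If_cases Int_def)
  also have "\<dots> \<le> (\<Sum>T\<in>Q. (real M / card V) ^ 4 * N)"
    using sup Q(2) by (intro sum_mono) (metis (no_types, lifting))
  also have "\<dots> = (real (card Q) * (real M / card V) ^ 4) * N" by simp
  also have "\<dots> \<le> (real n / 2) * N" using few N(2) by (intro mult_right_mono) auto
  also have "\<dots> \<le> ((real n + 1) / 2) * N" using N(2) by (intro mult_right_mono) auto
  finally have "(real n + 1) * real (card X) \<le> (real n + 1) * (N / 2)" by simp
  then have cX: "real (card X) \<le> N / 2" by (rule mult_left_le_imp_le) simp
  have "real (card Y) \<le> real (\<Sum>I\<in>B. card {S \<in> \<Omega>. I \<subseteq> S})"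
    unfolding Y_def of_nat_le_iff by (rule card_UN_le[OF B(1)])
  also have "\<dots> = (\<Sum>I\<in>B. real (card {S \<in> \<Omega>. I \<subseteq> S}))" by simp
  also have "\<dots> \<le> (\<Sum>I\<in>B. (real M / card V) ^ m * N)"
    using sup B(2) by (intro sum_mono) (metis (no_types, lifting))
  also have "\<dots> = (real (card B) * (real M / card V) ^ m) * N" by simp
  also have "\<dots> < (1 / 2) * N" using rare N(2) by (rule mult_strict_right_mono)
  finally have cY: "real (card Y) < N / 2" by simp
  have "\<Omega> \<subseteq> X \<union> Y"
    using neg by (auto simp: \<Omega>_def X_def Y_def not_le)
  then have "card \<Omega> \<le> card X + card Y"
    using finX finY by (meson card_Un_le card_mono finite_UnI order_trans)
  then have "real (card \<Omega>) \<le> real (card X) + real (card Y)" by linarith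
  then show False using N cX cY by linarith
qed

text \<open>The term of index \<open>m\<close> in the series of \<open>exp (real m)\<close> is at
  most the whole sum.\<close>

lemma fact_ge_power_div_exp: "(real m / exp 1) ^ m \<le> fact m"
proof -
  have "real m ^ m / fact m \<le> (\<Sum>k\<le>m. real m ^ k /\<^sub>R fact k)"
    by (rule member_le_sum[of m "{..m}" "\<lambda>k. real m ^ k /\<^sub>R fact k", THEN order_trans[rotated]])
      (auto simp: divide_inverse_commute)
  also have "\<dots> \<le> (\<Sum>k. real m ^ k /\<^sub>R fact k)"
    by (rule sum_le_suminf[OF sums_summable[OF exp_converges]]) auto
  also have "\<dots> = exp (real m)" using exp_converges by (rule sums_unique[symmetric])
  also have "\<dots> = exp 1 ^ m" by (simp flip: exp_of_nat_mult)
  finally show ?thesis by (simp add: power_divide field_simps)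
qed

lemma card_no_three_col_subsets:
  assumes \<C>: "covering no_three_col V \<C>" "\<And>C. C \<in> \<C> \<Longrightarrow> card C \<le> s" and "finite V"
  shows "real (card {I. I \<subseteq> V \<and> card I = m \<and> no_three_col I})
    \<le> real (card \<C>) * (exp 1 * real s / real m) ^ m"
proof -
  have fin: "finite C" if "C \<in> \<C>" for C
    using covering_sub[OF \<C>(1) that] \<open>finite V\<close> by (rule finite_subset)
  have one: "real (card {I. I \<subseteq> C \<and> card I = m}) \<le> (exp 1 * real s / real m) ^ m"
    if "C \<in> \<C>" for C
  proof -
    have "card {I. I \<subseteq> C \<and> card I = m} = card C choose m" using fin[OF that] by (rule n_subsets)
    also have "\<dots> \<le> s choose m" using \<C>(2)[OF that] by (rule binomial_right_mono)
    finally have "real (card {I. I \<subseteq> C \<and> card I = m}) \<le> real (s choose m)" by simp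
    also have "real (s choose m) * fact m \<le> real s ^ m"
      using binomial_fact_pow[of s m] by (metis of_nat_fact of_nat_le_iff of_nat_mult of_nat_power)
    then have "real (s choose m) * (real m / exp 1) ^ m \<le> real s ^ m"
      using fact_ge_power_div_exp[of m] by (smt (verit, best) mult_left_mono of_nat_0_le_iff)
    then have "real (s choose m) \<le> (exp 1 * real s / real m) ^ m"
      by (cases "m = 0") (simp_all add: power_divide power_mult_distrib field_simps)
    finally show ?thesis .
  qed
  have "{I. I \<subseteq> V \<and> card I = m \<and> no_three_col I} \<subseteq> (\<Union>C\<in>\<C>. {I. I \<subseteq> C \<and> card I = m})"
  proof
    fix I assume I: "I \<in> {I. I \<subseteq> V \<and> card I = m \<and> no_three_col I}"
    then obtain C where "C \<in> \<C>" "I \<subseteq> C" using coveringE[OF \<C>(1), of I] by blast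
    then show "I \<in> (\<Union>C\<in>\<C>. {I. I \<subseteq> C \<and> card I = m})" using I by blast
  qed
  then have "card {I. I \<subseteq> V \<and> card I = m \<and> no_three_col I}
      \<le> card (\<Union>C\<in>\<C>. {I. I \<subseteq> C \<and> card I = m})"
    by (rule card_mono[rotated]) (use fin covering_finite[OF \<C>(1)] in auto)
  also have "\<dots> \<le> (\<Sum>C\<in>\<C>. card {I. I \<subseteq> C \<and> card I = m})"
    by (rule card_UN_le[OF covering_finite[OF \<C>(1)]])
  finally have "real (card {I. I \<subseteq> V \<and> card I = m \<and> no_three_col I})
      \<le> (\<Sum>C\<in>\<C>. real (card {I. I \<subseteq> C \<and> card I = m}))"
    by (simp only: of_nat_le_iff flip: of_nat_sum)
  also have "\<dots> \<le> (\<Sum>C\<in>\<C>. (exp 1 * real s / real m) ^ m)" by (intro sum_mono one)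
  finally show ?thesis by simp
qed

text \<open>The difference \<open>harm n - ln n\<close> decreases from its value 1 at
  \<open>n = 1\<close>.\<close>

lemma harm_le_ln: "0 < n \<Longrightarrow> harm n \<le> ln (real n) + 1"
  using decseqD[OF decseq_harm_diff_ln, of 0 "n - 1"] by (simp add: harm_expand)

lemma no_three_col_subset: "no_three_col P \<Longrightarrow> R \<subseteq> P \<Longrightarrow> no_three_col R"
  unfolding no_three_col_def by blast

text \<open>A sample of \<open>2 * n\<close> points loses at most \<open>n\<close> when every
  collinear quadruple is destroyed; \<open>few\<close> bounds the expected number of quadruples by
  \<open>n / 2\<close>. For the union bound, \<open>sparse\<close> makes each container contribute
  at most \<open>exp (- m)\<close>, and \<open>count\<close> allows at most
  \<open>exp (m - 1)\<close> containers.\<close>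

lemma ex_lattice_set:
  assumes p: "4 \<le> p" and n: "0 < n" "2 * n \<le> p ^ 9" and "0 < m"
    and few: "864 * real n ^ 3 * (3 * ln p + 1) \<le> real p ^ 18"
    and sparse: "2 * exp 2 * real n \<le> real m * real p"
    and count: "120000 * real p ^ 5 * ln p * (64 * ln p + 1) + 1 \<le> real m"
  obtains S where "S \<subseteq> cube (p ^ 3)" "card S = n"
    "\<And>T. T \<in> collinear_quads (p ^ 3) \<Longrightarrow> \<not> T \<subseteq> S"
    "\<And>I. I \<subseteq> S \<Longrightarrow> no_three_col I \<Longrightarrow> card I < m"
proof -
  define V where "V = cube (p ^ 3)"
  define Q where "Q = collinear_quads (p ^ 3)"
  define B where "B = {I. I \<subseteq> V \<and> card I = m \<and> no_three_col I}"
  have finV: "finite V" and cardV: "card V = p ^ 9"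
    by (auto simp: V_def finite_cube card_cube simp flip: power_mult)
  have pp: "0 < real p" using p by simp
  obtain \<C> where C: "covering no_three_col V \<C>" "\<And>C. C \<in> \<C> \<Longrightarrow> card C \<le> p ^ 8"
    "ln (real (card \<C>)) \<le> 120000 * real p ^ 5 * ln p * (64 * ln p + 1)"
    using lattice_containers[OF p] unfolding V_def by blast
  define x where "x = real (2 * n) / real (card V)"
  have x: "x = 2 * real n / real p ^ 9" by (simp add: x_def cardV)
  have "real (card Q) \<le> 27 * real (p ^ 3) ^ 6 * harm (p ^ 3)"
    unfolding Q_def by (rule card_collinear_quads)
  also have "\<dots> \<le> 27 * real (p ^ 3) ^ 6 * (ln (real (p ^ 3)) + 1)"
    using p by (intro mult_left_mono harm_le_ln) auto
  also have "\<dots> = 27 * real p ^ 18 * (3 * ln p + 1)"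
    using pp by (simp add: ln_realpow flip: power_mult)
  finally have "2 * (real (card Q) * x ^ 4) \<le> 2 * ((27 * real p ^ 18 * (3 * ln p + 1)) * x ^ 4)"
    by (intro mult_left_mono mult_right_mono) auto
  \<comment> \<open>864 is 2 times 27 times the 16 from \<open>x ^ 4\<close>.\<close>
  also have "\<dots> = real n * (864 * real n ^ 3 * (3 * ln p + 1)) / real p ^ 18"
    using pp by (simp add: x power_divide field_simps power_eq_if)
  also have "\<dots> \<le> real n * real p ^ 18 / real p ^ 18"
    using few by (intro divide_right_mono mult_left_mono) auto
  finally have h1: "2 * (real (card Q) * x ^ 4) \<le> real n" using pp by simp

  have "real (card B) * x ^ m \<le> (real (card \<C>) * (exp 1 * real (p ^ 8) / real m) ^ m) * x ^ m"
    unfolding B_def using card_no_three_col_subsets[OF C(1,2) finV]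
    by (intro mult_right_mono) (auto simp: x)
  also have "\<dots> = real (card \<C>) * (exp 1 * real (p ^ 8) / real m * x) ^ m"
    by (simp only: power_mult_distrib mult.assoc)
  also have "\<dots> \<le> real (card \<C>) * exp (-1) ^ m"
  proof (intro mult_left_mono power_mono)
    have "exp 1 * real (p ^ 8) / real m * x = 2 * exp 1 * real n / (real m * real p)"
      using pp by (simp add: x field_simps power_eq_if)
    also have "\<dots> \<le> exp (-1)"
    proof -
      have "2 * exp 1 * real n = exp (-1) * (2 * exp 2 * real n)"
        by (simp add: algebra_simps flip: exp_add)
      also have "\<dots> \<le> exp (-1) * (real m * real p)" using sparse by (intro mult_left_mono) auto
      finally show ?thesis using \<open>0 < m\<close> pp by (simp add: divide_le_eq)
    qed
    finally show "exp 1 * real (p ^ 8) / real m * x \<le> exp (-1)" .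
  qed (auto simp: x)
  also have "\<dots> = real (card \<C>) * exp (- real m)" by (simp flip: exp_of_nat_mult)
  also have "\<dots> \<le> exp (real m - 1) * exp (- real m)"
  proof (rule mult_right_mono)
    have "real (card \<C>) \<le> exp (ln (real (card \<C>)))" by (cases "card \<C> = 0") auto
    also have "\<dots> \<le> exp (real m - 1)" using C(3) count by simp
    finally show "real (card \<C>) \<le> exp (real m - 1)" .
  qed simp
  also have "\<dots> = exp (-1)" by (simp flip: exp_add)
  also have "\<dots> < 1 / 2"
  proof -
    have "2 < exp (1 :: real)" using exp_lower_Taylor_quadratic[of "1 :: real"] by simp
    then show ?thesis by (simp add: exp_minus field_simps)
  qed
  finally have h2: "real (card B) * x ^ m < 1 / 2" .

  have "\<exists>S\<subseteq>V. card S = 2 * n \<and> card {T \<in> Q. T \<subseteq> S} \<le> n \<and> (\<forall>I\<in>B. \<not> I \<subseteq> S)"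
  proof (rule ex_subset_few_quads_no_bad)
    show "finite V" "finite Q" "finite B"
      using finV by (auto simp: B_def Q_def finite_collinear_quads)
    show "0 < card V" "2 * n \<le> card V" using p n by (auto simp: cardV)
    show "T \<subseteq> V \<and> card T = 4" if "T \<in> Q" for T
      using that by (simp add: Q_def V_def collinear_quads_def)
    show "I \<subseteq> V \<and> card I = m" if "I \<in> B" for I using that by (simp add: B_def)
  qed (use h1 h2 in \<open>simp_all only: x_def\<close>)
  then obtain S where S: "S \<subseteq> V" "card S = 2 * n" "card {T \<in> Q. T \<subseteq> S} \<le> n"
    and noB: "\<And>I. I \<in> B \<Longrightarrow> \<not> I \<subseteq> S" by blast
  \<comment> \<open>One deleted point for each quadruple inside \<open>S\<close>.\<close>
  define R where "R = (\<lambda>T. SOME t. t \<in> T) ` {T \<in> Q. T \<subseteq> S}"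
  have finQ: "finite {T \<in> Q. T \<subseteq> S}" by (simp add: Q_def finite_collinear_quads)
  have "card R \<le> n" unfolding R_def using card_image_le[OF finQ] S(3) by (rule order_trans)
  moreover have "finite R" unfolding R_def using finQ by (rule finite_imageI)
  ultimately have "n \<le> card (S - R)"
    using diff_card_le_card_Diff[of R S] S(2) by linarith
  then obtain S' where S': "S' \<subseteq> S - R" "card S' = n" by (rule obtain_subset_with_card_n)
  show thesis
  proof (rule that[of S'])
    show "S' \<subseteq> cube (p ^ 3)" "card S' = n" using S S' by (auto simp: V_def)
    show "\<not> T \<subseteq> S'" if "T \<in> collinear_quads (p ^ 3)" for T
    proof
      assume "T \<subseteq> S'"
      have "card T = 4" using that by (simp add: collinear_quads_def)
      then have "T \<noteq> {}" by auto
      then have "(SOME t. t \<in> T) \<in> T" by (simp add: some_in_eq)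
      moreover have "(SOME t. t \<in> T) \<in> R"
        using that \<open>T \<subseteq> S'\<close> S' unfolding R_def Q_def by blast
      ultimately show False using \<open>T \<subseteq> S'\<close> S' by blast
    qed
    show "card I < m" if "I \<subseteq> S'" "no_three_col I" for I
    proof (rule ccontr)
      assume "\<not> card I < m"
      then have "m \<le> card I" by simp
      then obtain J where J: "J \<subseteq> I" "card J = m" by (rule obtain_subset_with_card_n)
      have "J \<subseteq> S" using J that S' by blast
      moreover have "J \<in> B"
        using J \<open>J \<subseteq> S\<close> S(1) no_three_col_subset[OF that(2)] unfolding B_def by blast
      ultimately show False using noB by blast
    qed
  qed
qed

section \<open>Projection to the plane\<close>

text \<open>The cross product of two projected vectors is a polynomial in \<open>t\<close> whose coefficients are the
  entries of the cross product of the vectors; for large \<open>t\<close> it vanishes only if they all do.\<close>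

definition proj :: "int \<Rightarrow> lpoint \<Rightarrow> real \<times> real" where
  "proj t = (\<lambda>(x, y, z). (real_of_int (x + t * z), real_of_int (y + t\<^sup>2 * z)))"

text \<open>Uniqueness of digits in base \<open>t\<close>: \<open>t\<close> divides
  \<open>c0\<close>, which is too small to be a nonzero multiple; after division by \<open>t\<close>
  the same applies to \<open>c1\<close>.\<close>

lemma base_expansion_zero:
  fixes c0 c1 c2 t :: int
  assumes "c0 + t * c1 + t\<^sup>2 * c2 = 0" "\<bar>c0\<bar> < t" "\<bar>c1\<bar> < t"
  shows "c0 = 0 \<and> c1 = 0 \<and> c2 = 0"
proof -
  have t: "t \<noteq> 0" using assms(2) by auto
  have "c0 = t * (- c1 - t * c2)" using assms(1) by (simp add: algebra_simps power2_eq_square)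
  then have "t dvd c0" by (rule dvdI)
  then have c0: "c0 = 0" using assms(2) by (meson dvd_imp_le_int not_le abs_ge_self order_trans)
  then have "t * (c1 + t * c2) = 0" using assms(1) by (simp add: algebra_simps power2_eq_square)
  then have *: "c1 + t * c2 = 0" using t by simp
  then have "c1 = t * (- c2)" by simp
  then have "t dvd c1" by (rule dvdI)
  then have "c1 = 0" using assms(3) by (meson dvd_imp_le_int not_le abs_ge_self order_trans)
  then show ?thesis using c0 * t by simp
qed

lemma collinear3_proj:
  assumes abc: "a \<in> cube q" "b \<in> cube q" "c \<in> cube q" and t: "t = 2 * (int q)\<^sup>2 + 1"
  shows "collinear3 (proj t a) (proj t b) (proj t c) \<longleftrightarrow> col a b c"
proof -
  obtain a1 a2 a3 b1 b2 b3 c1 c2 c3 where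
    pts: "a = (a1, a2, a3)" "b = (b1, b2, b3)" "c = (c1, c2, c3)"
    by (metis prod.exhaust)
  define u1 u2 u3 v1 v2 v3 where
    uv: "u1 = b1 - a1" "u2 = b2 - a2" "u3 = b3 - a3" "v1 = c1 - a1" "v2 = c2 - a2" "v3 = c3 - a3"
  have bnd: "\<bar>u1\<bar> \<le> int q" "\<bar>u2\<bar> \<le> int q" "\<bar>u3\<bar> \<le> int q"
    "\<bar>v1\<bar> \<le> int q" "\<bar>v2\<bar> \<le> int q" "\<bar>v3\<bar> \<le> int q"
    using abc by (auto simp: pts cube_def uv)
  \<comment> \<open>Every entry of the cross product is at most \<open>2 * q\<^sup>2\<close> in
    absolute value, which explains the choice of \<open>t\<close>.\<close>
  have small: "\<bar>x * y - z * w\<bar> < t"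
    if "\<bar>x\<bar> \<le> int q" "\<bar>y\<bar> \<le> int q" "\<bar>z\<bar> \<le> int q" "\<bar>w\<bar> \<le> int q" for x y z w :: int
  proof -
    have "\<bar>x\<bar> * \<bar>y\<bar> \<le> int q * int q" "\<bar>z\<bar> * \<bar>w\<bar> \<le> int q * int q"
      using that by (auto intro!: mult_mono)
    then show ?thesis
      using abs_triangle_ineq4[of "x * y" "z * w"] by (simp add: t abs_mult power2_eq_square)
  qed
  have "(fst (proj t b) - fst (proj t a)) * (snd (proj t c) - snd (proj t a))
      - (snd (proj t b) - snd (proj t a)) * (fst (proj t c) - fst (proj t a))
      = real_of_int ((u1 * v2 - u2 * v1) + t * (u3 * v2 - u2 * v3) + t\<^sup>2 * (u1 * v3 - u3 * v1))"
    by (simp add: proj_def pts uv) algebra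
  then have "collinear3 (proj t a) (proj t b) (proj t c) \<longleftrightarrow>
      (u1 * v2 - u2 * v1) + t * (u3 * v2 - u2 * v3) + t\<^sup>2 * (u1 * v3 - u3 * v1) = 0"
    unfolding collinear3_def by (simp only: of_int_eq_0_iff)
  also have "\<dots> \<longleftrightarrow> u1 * v2 - u2 * v1 = 0 \<and> u3 * v2 - u2 * v3 = 0 \<and> u1 * v3 - u3 * v1 = 0"
    using base_expansion_zero[OF _ small small] bnd by (metis add.left_neutral mult_zero_right)
  also have "\<dots> \<longleftrightarrow> col a b c"
    by (auto simp: pts uv)
  finally show ?thesis .
qed

lemma inj_on_proj:
  assumes t: "t = 2 * (int q)\<^sup>2 + 1"
  shows "inj_on (proj t) (cube q)"
proof (rule inj_onI)
  fix a b assume ab: "a \<in> cube q" "b \<in> cube q" "proj t a = proj t b"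
  obtain a1 a2 a3 b1 b2 b3 where pts: "a = (a1, a2, a3)" "b = (b1, b2, b3)"
    by (metis prod.exhaust)
  have eq: "a1 + t * a3 = b1 + t * b3" "a2 + t\<^sup>2 * a3 = b2 + t\<^sup>2 * b3"
    using ab(3) by (simp_all add: proj_def pts flip: of_int_add of_int_mult of_int_power)
  have "int q \<le> (int q)\<^sup>2" by (cases "q = 0") (auto simp: power2_eq_square)
  moreover have "\<bar>a1 - b1\<bar> \<le> int q" "\<bar>a3 - b3\<bar> \<le> int q" using ab by (auto simp: pts cube_def)
  ultimately have "\<bar>a1 - b1\<bar> < t" "\<bar>a3 - b3\<bar> < t" unfolding t by linarith+
  moreover have "(a1 - b1) + t * (a3 - b3) + t\<^sup>2 * 0 = 0" using eq(1) by (simp add: algebra_simps)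
  ultimately have "a1 - b1 = 0 \<and> a3 - b3 = 0" using base_expansion_zero by blast
  then show "a = b" using eq(2) by (simp add: pts)
qed

text \<open>The differences \<open>b - a\<close> and \<open>c - a\<close> are both parallel to the
  nonzero vector \<open>q - p\<close>. This connects lines given by two arbitrary points of the
  plane with collinear triples of the set.\<close>

lemma collinear3_on_line:
  assumes "p \<noteq> q" "collinear3 p q a" "collinear3 p q b" "collinear3 p q c"
  shows "collinear3 a b c"
proof -
  define d1 d2 \<beta>1 \<beta>2 \<gamma>1 \<gamma>2 where d: "d1 = fst q - fst p" "d2 = snd q - snd p"
    "\<beta>1 = fst b - fst a" "\<beta>2 = snd b - snd a" "\<gamma>1 = fst c - fst a" "\<gamma>2 = snd c - snd a"
  have "d1 * \<beta>2 = d2 * \<beta>1" "d1 * \<gamma>2 = d2 * \<gamma>1"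
    using assms(2-4) unfolding collinear3_def d by (auto simp: algebra_simps)
  then have "d1 * (\<beta>1 * \<gamma>2 - \<beta>2 * \<gamma>1) = 0" "d2 * (\<beta>1 * \<gamma>2 - \<beta>2 * \<gamma>1) = 0" by algebra+
  moreover have "d1 \<noteq> 0 \<or> d2 \<noteq> 0" using assms(1) by (auto simp: d prod_eq_iff)
  ultimately have "\<beta>1 * \<gamma>2 - \<beta>2 * \<gamma>1 = 0" by auto
  then show ?thesis by (simp add: collinear3_def d)
qed

text \<open>\<open>Min\<close> and \<open>Max\<close> carry information only on finite nonempty
  sets. There are infinitely many sets \<open>S\<close>, but the values \<open>alpha_set S\<close>
  are at most \<open>n\<close>.\<close>

lemma alpha_le:
  assumes S: "finite S" "card S = n" "no_four_on_line S"
    and bound: "\<And>P. P \<subseteq> S \<Longrightarrow> general_position P \<Longrightarrow> card P \<le> k"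
  shows "alpha n \<le> k"
proof -
  have bounds: "finite {card P | P. P \<subseteq> S \<and> general_position P}"
    "{card P | P. P \<subseteq> S \<and> general_position P} \<noteq> {}"
    if "finite S" for S
  proof -
    show "finite {card P | P. P \<subseteq> S \<and> general_position P}"
      by (rule finite_subset[of _ "card ` Pow S"]) (use that in auto)
    have "general_position {}" by (simp add: general_position_def)
    then show "{card P | P. P \<subseteq> S \<and> general_position P} \<noteq> {}" by blast
  qed
  have le_card: "alpha_set S \<le> card S" if "finite S" for S
    unfolding alpha_set_def using bounds[OF that] that by (subst Max_le_iff) (auto intro: card_mono)
  have "finite {alpha_set S | S. finite S \<and> card S = n \<and> no_four_on_line S}"
    by (rule finite_subset[of _ "{..n}"]) (use le_card in auto)
  then have "alpha n \<le> alpha_set S"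
    unfolding alpha_def using S by (intro Min_le) auto
  also have "\<dots> \<le> k"
    unfolding alpha_set_def using bounds[OF S(1)] bound by (subst Max_le_iff) auto
  finally show ?thesis .
qed

text \<open>The projection is injective on \<open>S\<close> and respects collinearity both ways, so
  four image points on a line pull back to a collinear quadruple, and an image subset in general
  position pulls back to one without collinear triples.\<close>

lemma alpha_le_of_lattice_set:
  assumes S: "S \<subseteq> cube q" "card S = n"
    and quads: "\<And>T. T \<in> collinear_quads q \<Longrightarrow> \<not> T \<subseteq> S"
    and gp: "\<And>I. I \<subseteq> S \<Longrightarrow> no_three_col I \<Longrightarrow> card I \<le> k"
  shows "alpha n \<le> k"
proof -
  define t where "t = 2 * (int q)\<^sup>2 + 1"
  have inj: "inj_on (proj t) S"
    using inj_on_proj[OF t_def] S(1) by (rule inj_on_subset)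
  have finS: "finite S" using S(1) finite_cube by (rule finite_subset)
  have lift: "\<exists>I\<subseteq>S. W = proj t ` I \<and> card I = card W" if W: "W \<subseteq> proj t ` S" for W
  proof -
    obtain I where "I \<subseteq> S" "W = proj t ` I" using W by (rule subset_imageE)
    moreover have "card (proj t ` I) = card I"
      using inj \<open>I \<subseteq> S\<close> by (meson card_image inj_on_subset)
    ultimately show ?thesis by auto
  qed
  show ?thesis
  proof (rule alpha_le[of "proj t ` S"])
    show "finite (proj t ` S)" "card (proj t ` S) = n"
      using finS inj S(2) by (auto simp: card_image)
    show "no_four_on_line (proj t ` S)"
      unfolding no_four_on_line_def
    proof (intro allI impI, elim exE conjE, rule ccontr)
      fix L p q' assume L: "p \<noteq> q'" "L = {x. collinear3 p q' x}"
        and "\<not> card (proj t ` S \<inter> L) \<le> 3"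
      then have "4 \<le> card (proj t ` S \<inter> L)" by simp
      then obtain W where W: "W \<subseteq> proj t ` S \<inter> L" "card W = 4"
        by (rule obtain_subset_with_card_n)
      have "W \<subseteq> proj t ` S" using W(1) by blast
      from lift[OF this] obtain T where T: "T \<subseteq> S" "W = proj t ` T" "card T = 4"
        unfolding W(2) by blast
      have "col x y z" if "x \<in> T" "y \<in> T" "z \<in> T" for x y z
      proof -
        have "proj t x \<in> L" "proj t y \<in> L" "proj t z \<in> L" using that T(2) W(1) by auto
        then have "collinear3 (proj t x) (proj t y) (proj t z)"
          using collinear3_on_line[OF L(1)] unfolding L(2) by blast
        moreover have "x \<in> cube q" "y \<in> cube q" "z \<in> cube q" using that T(1) S(1) by auto
        ultimately show ?thesis using collinear3_proj[OF _ _ _ t_def] by blast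
      qed
      then have "T \<in> collinear_quads q"
        using T S(1) unfolding collinear_quads_def by blast
      then show False using quads T(1) by blast
    qed
    show "card P \<le> k" if P: "P \<subseteq> proj t ` S" "general_position P" for P
    proof -
      obtain I where I: "I \<subseteq> S" "P = proj t ` I" "card I = card P" using lift[OF P(1)] by blast
      have "no_three_col I"
        unfolding no_three_col_def
      proof (intro ballI impI, elim conjE)
        fix x y z assume xyz: "x \<in> I" "y \<in> I" "z \<in> I" "x \<noteq> y" "x \<noteq> z" "y \<noteq> z"
        then have "proj t x \<noteq> proj t y" "proj t x \<noteq> proj t z" "proj t y \<noteq> proj t z"
          using inj_onD[OF inj] subsetD[OF I(1)] by blast+
        then have "\<not> collinear3 (proj t x) (proj t y) (proj t z)"
          using P(2) xyz I(2) unfolding general_position_def by blast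
        moreover have "x \<in> cube q" "y \<in> cube q" "z \<in> cube q" using xyz I(1) S(1) by auto
        ultimately show "\<not> col x y z" using collinear3_proj[OF _ _ _ t_def] by blast
      qed
      then show ?thesis using gp[OF I(1)] I(3) by simp
    qed
  qed
qed


section \<open>The upper bound for alpha\<close>

theorem theorem2p1:
  shows "\<forall>\<delta>>0. \<forall>\<^sub>F n in at_top. real (alpha n) \<le> real n powr (5/6 + \<delta>)"
proof (intro allI impI)
  fix \<delta> :: real assume "0 < \<delta>"
  \<comment> \<open>Without the \<open>\<delta>/10\<close> this would be \<open>n = p ^ 6\<close>, a
    sample of order \<open>q\<^sup>2\<close>. The surplus absorbs the logarithm in the number of
    quadruples, while \<open>y ^ 5\<close> is only \<open>n powr (5/6 + \<delta>/2)\<close>, which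
    leaves room for the logarithms in the number of containers.\<close>
  define y where "y = (\<lambda>n :: nat. real n powr (1/6 + \<delta>/10))"
  have "\<forall>\<^sub>F n in at_top. 4 \<le> y n"
    "\<forall>\<^sub>F n in at_top. 2 * real n \<le> y n ^ 9"
    "\<forall>\<^sub>F n in at_top. 864 * real n ^ 3 * (3 * ln (y n + 1) + 1) \<le> y n ^ 18"
    "\<forall>\<^sub>F n in at_top. 2 * exp 2 * real n \<le> real n powr (5/6 + \<delta>) * y n"
    "\<forall>\<^sub>F n in at_top. 120000 * (y n + 1) ^ 5 * ln (y n + 1) * (64 * ln (y n + 1) + 1) + 1
      \<le> real n powr (5/6 + \<delta>)"
    unfolding y_def using \<open>0 < \<delta>\<close> by real_asymp+
  with eventually_gt_at_top[of 0]
  show "\<forall>\<^sub>F n in at_top. real (alpha n) \<le> real n powr (5/6 + \<delta>)"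
  proof eventually_elim
    case (elim n)
    define p where "p = nat \<lceil>y n\<rceil>"
    \<comment> \<open>The lattice set is built for \<open>m = k + 1\<close>, which is at least the
      real bound as its hypotheses require, and \<open>card I < k + 1\<close> returns
      \<open>card I \<le> k\<close>, which is below the bound.\<close>
    define k where "k = nat \<lfloor>real n powr (5/6 + \<delta>)\<rfloor>"
    have p: "y n \<le> real p" "real p \<le> y n + 1" using elim(2) unfolding p_def by linarith+
    have k: "real k \<le> real n powr (5/6 + \<delta>)" "real n powr (5/6 + \<delta>) \<le> real (k + 1)"
      unfolding k_def using powr_ge_zero[of "real n" "5/6 + \<delta>"] by linarith+
    have p4: "4 \<le> p" using p elim(2) by linarith
    then have lnp: "0 \<le> ln (real p)" "ln (real p) \<le> ln (y n + 1)" using p by auto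
    have pow: "y n ^ j \<le> real p ^ j" "real p ^ j \<le> (y n + 1) ^ j" for j
      using p elim(2) by (auto intro!: power_mono)
    have "real (2 * n) \<le> real (p ^ 9)" using elim(3) pow(1)[of 9] by simp
    then have "2 * n \<le> p ^ 9" by (simp only: of_nat_le_iff)
    moreover have "864 * real n ^ 3 * (3 * ln p + 1) \<le> real p ^ 18"
    proof -
      have "864 * real n ^ 3 * (3 * ln p + 1) \<le> 864 * real n ^ 3 * (3 * ln (y n + 1) + 1)"
        using lnp by (intro mult_left_mono) auto
      then show ?thesis using elim(4) pow(1)[of 18] by linarith
    qed
    moreover have "2 * exp 2 * real n \<le> real (k + 1) * real p"
      using elim(5) mult_mono[OF k(2) p(1)] elim(2) by simp
    moreover have "120000 * real p ^ 5 * ln p * (64 * ln p + 1) + 1 \<le> real (k + 1)"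
    proof -
      have "120000 * real p ^ 5 * ln p * (64 * ln p + 1)
          \<le> 120000 * (y n + 1) ^ 5 * ln (y n + 1) * (64 * ln (y n + 1) + 1)"
        using lnp pow(2)[of 5] elim(2) by (intro mult_mono add_mono) auto
      then show ?thesis using elim(6) k(2) by linarith
    qed
    ultimately obtain S where "S \<subseteq> cube (p ^ 3)" "card S = n"
      "\<And>T. T \<in> collinear_quads (p ^ 3) \<Longrightarrow> \<not> T \<subseteq> S"
      "\<And>I. I \<subseteq> S \<Longrightarrow> no_three_col I \<Longrightarrow> card I < k + 1"
      using ex_lattice_set[OF p4 elim(1), of "k + 1"] by auto
    then have "alpha n \<le> k"
      by (intro alpha_le_of_lattice_set[of S "p ^ 3"]) (auto simp: less_Suc_eq_le)
    then show "real (alpha n) \<le> real n powr (5/6 + \<delta>)" using k(1) by linarith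
  qed
qed

end
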